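(* Let $n\ge 2$ and let the matrix $\mathbf{A}$ of a linear operator $A:\mathbb{R}^n\to\mathbb{R}^n$ be $\mathcal{J}$-sign-symmetric and irreducible. Let its second compound matrix $\mathbf{A}^{(2)}$ be $\mathcal{J}$-sign-symmetric. Then $\lambda_1=\rho(A)$ is a simple positive eigenvalue of $A$. Moreover: (1) If at least one of the possible sets $\widehat{W}(\mathcal{J},\widetilde{\mathcal{J}})$ is transitive, then $h(A)=1$, and the second in modulus eigenvalue $\lambda_2$ of $A$ is nonnegative and different in modulus from the first eigenvalue; that is, the eigenvalues of $A$, repeated according to multiplicity, can be enumerated as $\lambda_1,\ldots,\lambda_n$ with $|\lambda_1|\ge|\lambda_2|\ge\cdots\ge|\lambda_n|$, $\lambda_1=\rho(A)$, and $0\le\lambda_2<\lambda_1$. (2) If all the possible sets $\widehat{W}(\mathcal{J},\widetilde{\mathcal{J}})$ are not transitive, then there is an odd number $k\ge 1$ of eigenvalues of $A$ on the spectral circle $|\lambda|=\rho(A)$; all of them are simple and they coincide with the $k$th roots of $(\rho(A))^k$.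
   Context: A real $N\times N$ matrix $\mathbf{M}=\{m_{ij}\}$ is called $\mathcal{J}$-sign-symmetric if there exists a subset $\mathcal{J}\subseteq\{1,\ldots,N\}$ such that: (a) $m_{ij}\le 0$ whenever exactly one of the indices $i,j$ belongs to $\mathcal{J}$; and (b) $m_{ij}<0$ implies that exactly one of $i,j$ belongs to $\mathcal{J}$. A set $\mathcal{J}$ with (a) and (b) is called a set in the definition of $\mathcal{J}$-sign-symmetricity of $\mathbf{M}$; it need not be unique. The term is existential: $\mathbf{A}$ and $\mathbf{A}^{(2)}$ each have their own such sets. A matrix is reducible if it can be brought by a simultaneous permutation of rows and columns to the form $\begin{pmatrix}\mathbf{A}_1&0\\ \mathbf{B}&\mathbf{A}_2\end{pmatrix}$ with nonempty square blocks $\mathbf{A}_1,\mathbf{A}_2$; otherwise it is irreducible. $\rho(A)$ is the spectral radius of $A$, and $h(A)$, the index of imprimitivity of the irreducible operator $A$, is the number of eigenvalues of $A$ equal in modulus to $\rho(A)$. The second compound matrix $\mathbf{A}^{(2)}$ is the $C_n^2\times C_n^2$ matrix, $C_n^2=\frac{n(n-1)}{2}$, of the minors of $\mathbf{A}$ formed by rows $i,j$ and columns $k,l$, where $1\le i<j\le n$, $1\le k<l\le n$, with the pairs numbered in lexicographic order. For $i<j$, let $\alpha(i,j)\in\{1,\ldots,C_n^2\}$ be the number of the pair $(i,j)$ in the lexicographic numeration. Let $\mathcal{J}\subseteq\{1,\ldots,n\}$ be a set in the definition of $\mathcal{J}$-sign-symmetricity of $\mathbf{A}$ and $\widetilde{\mathcal{J}}\subseteq\{1,\ldots,C_n^2\}$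 a set in the definition of $\mathcal{J}$-sign-symmetricity of $\mathbf{A}^{(2)}$. The set $\widehat{W}(\mathcal{J},\widetilde{\mathcal{J}})\subseteq\{1,\ldots,n\}\times\{1,\ldots,n\}$ is defined as follows: $(i,j)\in\widehat{W}(\mathcal{J},\widetilde{\mathcal{J}})$ if and only if one of the following holds: (a) $i<j$, the numbers $i,j$ both belong to $\mathcal{J}$ or both belong to $\{1,\ldots,n\}\setminus\mathcal{J}$, and $\alpha(i,j)\in\widetilde{\mathcal{J}}$; (b) $i<j$, exactly one of $i,j$ belongs to $\mathcal{J}$, and $\alpha(i,j)\in\{1,\ldots,C_n^2\}\setminus\widetilde{\mathcal{J}}$; (c) $i>j$, the numbers $i,j$ both belong to $\mathcal{J}$ or both belong to $\{1,\ldots,n\}\setminus\mathcal{J}$, and $\alpha(j,i)\in\{1,\ldots,C_n^2\}\setminus\widetilde{\mathcal{J}}$; (d) $i>j$, exactly one of $i,j$ belongs to $\mathcal{J}$, and $\alpha(j,i)\in\widetilde{\mathcal{J}}$. The "possible sets $\widehat{W}(\mathcal{J},\widetilde{\mathcal{J}})$" are all those obtained from all admissible choices of $\mathcal{J}$ and $\widetilde{\mathcal{J}}$. Such a set $W$ is called transitive if, for all pairwise distinct $i,j,k\in\{1,\ldots,n\}$, $(i,j)\in W$ and $(j,k)\in W$ imply $(i,k)\in W$. (For $i\neq j$ exactly one of $(i,j),(j,i)$ belongs to $\widehat{W}(\mathcal{J},\widetilde{\mathcal{J}})$, so including or omitting diagonal pairs $(i,i)$ does not affect transitivity.) *)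

theory Defs
  imports
    "HOL-Combinatorics.Permutations"
    "Jordan_Normal_Form.Spectral_Radius"
    "Jordan_Normal_Form.DL_Submatrix"
begin

text \<open>
  Matrices are those of \<^theory>\<open>Jordan_Normal_Form.Matrix\<close>, so rows and columns are numbered
  from \<open>0\<close>; accordingly all index sets below are subsets of \<open>{..<n}\<close> rather than \<open>{1, \<dots>, n}\<close>,
  and the numbering of pairs starts at \<open>0\<close>.
\<close>

subsection \<open>Sign-symmetric matrices\<close>

definition sign_symmetry_set :: "real mat \<Rightarrow> nat set \<Rightarrow> bool" where
  "sign_symmetry_set M J \<longleftrightarrow>
     square_mat M \<and> J \<subseteq> {..<dim_row M} \<and>
     (\<forall>i<dim_row M. \<forall>j<dim_row M. (i \<in> J) \<noteq> (j \<in> J) \<longrightarrow> M $$ (i, j) \<le> 0) \<and>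
     (\<forall>i<dim_row M. \<forall>j<dim_row M. M $$ (i, j) < 0 \<longrightarrow> (i \<in> J) \<noteq> (j \<in> J))"

definition J_sign_symmetric :: "real mat \<Rightarrow> bool" where
  "J_sign_symmetric M \<longleftrightarrow> (\<exists>J. sign_symmetry_set M J)"

subsection \<open>Reducibility\<close>

definition reducible_mat :: "'a::zero mat \<Rightarrow> bool" where
  "reducible_mat A \<longleftrightarrow>
     (\<exists>p r s A1 B A2. p permutes {..<dim_row A} \<and> 1 \<le> r \<and> 1 \<le> s \<and>
        A1 \<in> carrier_mat r r \<and> B \<in> carrier_mat s r \<and> A2 \<in> carrier_mat s s \<and>
        mat (dim_row A) (dim_col A) (\<lambda>(i, j). A $$ (p i, p j)) =
          four_block_mat A1 (0\<^sub>m r s) B A2)"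

definition irreducible_mat :: "'a::zero mat \<Rightarrow> bool" where
  "irreducible_mat A \<longleftrightarrow> square_mat A \<and> \<not> reducible_mat A"

subsection \<open>Spectrum of a real matrix\<close>

abbreviation complex_mat :: "real mat \<Rightarrow> complex mat" where
  "complex_mat A \<equiv> map_mat complex_of_real A"

abbreviation rho :: "real mat \<Rightarrow> real" where
  "rho A \<equiv> spectral_radius (complex_mat A)"

definition simple_eigenvalue :: "complex mat \<Rightarrow> complex \<Rightarrow> bool" where
  "simple_eigenvalue A z \<longleftrightarrow> eigenvalue A z \<and> Polynomial.order z (char_poly A) = 1"

definition peripheral_spectrum :: "complex mat \<Rightarrow> complex set" where
  "peripheral_spectrum A = {z \<in> spectrum A. cmod z = spectral_radius A}"

text \<open>Eigenvalues are counted with algebraic multiplicity.\<close>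

definition imprimitivity_index :: "real mat \<Rightarrow> nat" where
  "imprimitivity_index A =
     (\<Sum>z\<in>peripheral_spectrum (complex_mat A). Polynomial.order z (char_poly (complex_mat A)))"

definition eigenvalue_enumeration :: "complex mat \<Rightarrow> complex list \<Rightarrow> bool" where
  "eigenvalue_enumeration A es \<longleftrightarrow>
     length es = dim_row A \<and> char_poly A = (\<Prod>e\<leftarrow>es. [:- e, 1:])"

subsection \<open>The second compound matrix\<close>

definition lex_pairs :: "nat \<Rightarrow> (nat \<times> nat) list" where
  "lex_pairs n = [(i, j). i \<leftarrow> [0..<n], j \<leftarrow> [Suc i..<n]]"

text \<open>For \<open>i < j < n\<close>, the number of the pair \<open>(i, j)\<close> in the lexicographic numeration.\<close>

definition pair_number :: "nat \<Rightarrow> nat \<Rightarrow> nat \<Rightarrow> nat" where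
  "pair_number n i j = (THE r. r < length (lex_pairs n) \<and> lex_pairs n ! r = (i, j))"

definition second_compound :: "'a::comm_ring_1 mat \<Rightarrow> 'a mat" where
  "second_compound A =
     (let ps = lex_pairs (dim_row A)
      in mat (length ps) (length ps)
           (\<lambda>(r, s). let (i, j) = ps ! r; (k, l) = ps ! s in det (submatrix A {i, j} {k, l})))"

lemma set_lex_pairs: "set (lex_pairs n) = {(i, j). i < j \<and> j < n}"
  by (force simp: lex_pairs_def)

lemma length_lex_pairs: "length (lex_pairs n) = n * (n - 1) div 2"
proof -
  have "length (lex_pairs n) = (\<Sum>i<n. n - Suc i)"
    by (simp add: lex_pairs_def length_concat o_def interv_sum_list_conv_sum_set_nat
        atLeast0LessThan)
  also have "\<dots> = (\<Sum>i<n. i)"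
    by (rule sum.nat_diff_reindex)
  also have "\<dots> = n * (n - 1) div 2"
    using Sum_Ico_nat[of 0 n] by (simp add: atLeast0LessThan)
  finally show ?thesis .
qed

lemma sorted_lex_pairs:
  "sorted_wrt (\<lambda>(i, j) (k, l). i < k \<or> i = k \<and> j < l) (lex_pairs n)"
proof -
  have "sorted_wrt (\<lambda>(i, j) (k, l). i < k \<or> i = k \<and> j < l)
          (concat (map (\<lambda>i. map (Pair i) [Suc i..<n]) [0..<m]))" for m
    by (induction m)
      (auto simp: sorted_wrt_append sorted_wrt_map sorted_wrt_upt)
  then show ?thesis
    by (simp add: lex_pairs_def)
qed

lemma distinct_lex_pairs: "distinct (lex_pairs n)"
proof -
  have "sorted_wrt (\<noteq>) (lex_pairs n)"
    by (rule sorted_wrt_mono_rel[OF _ sorted_lex_pairs]) auto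
  then show ?thesis
    by (simp add: distinct_conv_nth sorted_wrt_iff_nth_less) (metis linorder_neqE_nat)
qed

lemma pair_number:
  assumes "i < j" "j < n"
  shows "pair_number n i j < n * (n - 1) div 2"
    and "lex_pairs n ! pair_number n i j = (i, j)"
proof -
  have "\<exists>!r. r < length (lex_pairs n) \<and> lex_pairs n ! r = (i, j)"
    using assms distinct_Ex1[OF distinct_lex_pairs, of "(i, j)" n] by (simp add: set_lex_pairs)
  from theI'[OF this] show "pair_number n i j < n * (n - 1) div 2"
    and "lex_pairs n ! pair_number n i j = (i, j)"
    by (simp_all add: pair_number_def length_lex_pairs)
qed

lemma dim_second_compound [simp]:
  "dim_row (second_compound A) = dim_row A * (dim_row A - 1) div 2"
  "dim_col (second_compound A) = dim_row A * (dim_row A - 1) div 2"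
  by (simp_all add: second_compound_def Let_def length_lex_pairs)

lemma det_submatrix_pair:
  fixes A :: "'a::comm_ring_1 mat"
  assumes A: "A \<in> carrier_mat n n" and "i < j" "j < n" "k < l" "l < n"
  shows "det (submatrix A {i, j} {k, l}) = A $$ (i, k) * A $$ (j, l) - A $$ (i, l) * A $$ (j, k)"
proof -
  have pick: "pick {a, b} 0 = a" "pick {a, b} (Suc 0) = b" if "a < b" for a b :: nat
  proof -
    show a: "pick {a, b} 0 = a"
      using that by (auto intro!: Least_equality)
    show "pick {a, b} (Suc 0) = b"
      using that a by (auto intro!: Least_equality)
  qed
  have card: "card {x. x < n \<and> x \<in> {a, b}} = 2" if "a < b" "b < n" for a b :: nat
  proof -
    have "{x. x < n \<and> x \<in> {a, b}} = {a, b}" using that by auto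
    then show ?thesis using that by simp
  qed
  have "submatrix A {i, j} {k, l} = mat 2 2 (\<lambda>(a, b). A $$ (pick {i, j} a, pick {k, l} b))"
    using A card[OF assms(2,3)] card[OF assms(4,5)] by (simp add: submatrix_def)
  moreover have "det M = M $$ (0, 0) * M $$ (1, 1) - M $$ (0, 1) * M $$ (1, 0)"
    if "M \<in> carrier_mat 2 2" for M :: "'a mat"
    using that
    by (subst laplace_expansion_row[of M 2 0])
      (auto simp: numeral_2_eq_2 cofactor_def mat_delete_def det_single)
  ultimately show ?thesis
    by (simp add: pick[OF assms(2)] pick[OF assms(4)]
        del: pick.simps)
qed

lemma second_compound_entry:
  fixes A :: "'a::comm_ring_1 mat"
  assumes "A \<in> carrier_mat n n" "i < j" "j < n" "k < l" "l < n"
  shows "second_compound A $$ (pair_number n i j, pair_number n k l) =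
           A $$ (i, k) * A $$ (j, l) - A $$ (i, l) * A $$ (j, k)"
  using assms det_submatrix_pair[OF assms] pair_number[OF assms(2,3)] pair_number[OF assms(4,5)]
  by (simp add: second_compound_def Let_def length_lex_pairs)

subsection \<open>The relation of the two sign structures\<close>

definition W_hat :: "nat \<Rightarrow> nat set \<Rightarrow> nat set \<Rightarrow> (nat \<times> nat) set" where
  "W_hat n J Jt = {(i, j). i < n \<and> j < n \<and>
     (i < j \<and> (i \<in> J \<longleftrightarrow> j \<in> J) \<and> pair_number n i j \<in> Jt \<or>
      i < j \<and> (i \<in> J) \<noteq> (j \<in> J) \<and> pair_number n i j \<notin> Jt \<or>
      j < i \<and> (i \<in> J \<longleftrightarrow> j \<in> J) \<and> pair_number n j i \<notin> Jt \<or>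
      j < i \<and> (i \<in> J) \<noteq> (j \<in> J) \<and> pair_number n j i \<in> Jt)}"

definition possible_W_hats :: "real mat \<Rightarrow> (nat \<times> nat) set set" where
  "possible_W_hats A =
     {W_hat (dim_row A) J Jt | J Jt.
        sign_symmetry_set A J \<and> sign_symmetry_set (second_compound A) Jt}"

definition transitive_W :: "nat \<Rightarrow> (nat \<times> nat) set \<Rightarrow> bool" where
  "transitive_W n W \<longleftrightarrow>
     (\<forall>i<n. \<forall>j<n. \<forall>k<n. i \<noteq> j \<and> j \<noteq> k \<and> i \<noteq> k \<longrightarrow>
        (i, j) \<in> W \<longrightarrow> (j, k) \<in> W \<longrightarrow> (i, k) \<in> W)"

end

theory Submission
  imports Defs
begin

text \<open>
  Conjugating \<open>A\<close> by the signs of a symmetry set gives a nonnegative irreducible matrix \<open>P\<close>, and the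
  signs of the second compound become an antisymmetric function \<open>s\<close> on pairs of indices with
  \<open>s i j * s k l * minor2 P i j k l \<ge> 0\<close>; the set \<open>W\<close> is \<open>{(i, j). s i j = 1}\<close>. By Perron-Frobenius theory
  the peripheral eigenvalues of \<open>P\<close> are simple and are the \<open>h\<close>-th roots of \<open>r ^ h\<close>.

  The sign condition on minors is inherited by powers (Cauchy-Binet), so the power sums of the
  products \<open>\<lambda>\<^sub>i \<lambda>\<^sub>j\<close> with \<open>i \<noteq> j\<close>, which are \<open>(tr P\<^sup>k)\<^sup>2 - tr P\<^sup>2\<^sup>k\<close>, are nonnegative. Taking Cesaro
  means, a finite family with nonnegative power sums attains its maximal modulus \<open>R\<close> as a value, at
  least as often as any other value of modulus \<open>R\<close>. Counting the pairs of peripheral eigenvalues with a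
  given product shows that \<open>h\<close> is odd, and for \<open>h = 1\<close> that \<open>\<lambda>\<^sub>2 \<ge> 0\<close>. If \<open>W\<close> is transitive, it has a
  least element \<open>m\<close>; with \<open>P m l > 0\<close> and \<open>P j m > 0\<close> the minor of rows \<open>m, j\<close> and columns \<open>m, l\<close> forces
  \<open>P m m > 0\<close>, hence \<open>h = 1\<close>.
\<close>


subsection \<open>Nonnegative power sums\<close>

text \<open>For \<open>z\<close> other than \<open>1\<close> the geometric sums are bounded by
  \<open>2 / cmod (z - 1)\<close>, so division by \<open>N\<close> sends them to
  \<open>0\<close>.\<close>

lemma cesaro_powers:
  fixes z :: complex
  assumes "cmod z \<le> 1"
  shows "(\<lambda>N. (\<Sum>k<N. z ^ Suc k) / of_nat N) \<longlonglongrightarrow> (if z = 1 then 1 else 0)"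
proof (cases "z = 1")
  case True
  have "\<forall>\<^sub>F N in sequentially. (\<Sum>k<N. z ^ Suc k) / of_nat N = 1"
    using eventually_gt_at_top[of 0] by eventually_elim (simp add: True)
  then show ?thesis
    using True by (simp add: tendsto_eventually)
next
  case False
  have bound: "norm ((\<Sum>k<N. z ^ Suc k) / of_nat N) \<le> (2 / cmod (z - 1)) * (1 / real N)" for N
  proof -
    have "(\<Sum>k<N. z ^ Suc k) = z * ((z ^ N - 1) / (z - 1))"
      unfolding geometric_sum[OF False, symmetric] by (simp add: sum_distrib_left)
    moreover have "cmod (z ^ N - 1) \<le> 2"
      using norm_triangle_ineq4[of "z ^ N" 1] power_mono[OF assms, of N] by (simp add: norm_power)
    then have "cmod z * cmod (z ^ N - 1) \<le> 1 * 2"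
      using assms by (intro mult_mono) auto
    ultimately show ?thesis
      using False by (simp add: norm_mult norm_divide divide_right_mono)
  qed
  have "(\<lambda>N. (2 / cmod (z - 1)) * (1 / real N)) \<longlonglongrightarrow> (2 / cmod (z - 1)) * 0"
    by (rule tendsto_mult_left[OF lim_1_over_n])
  then have lim: "(\<lambda>N. (2 / cmod (z - 1)) * (1 / real N)) \<longlonglongrightarrow> 0"
    by simp
  have "(\<lambda>N. norm ((\<Sum>k<N. z ^ Suc k) / of_nat N)) \<longlonglongrightarrow> 0"
    by (rule tendsto_sandwich[OF always_eventually always_eventually tendsto_const lim])
      (use bound in simp_all)
  then have "(\<lambda>N. (\<Sum>k<N. z ^ Suc k) / of_nat N) \<longlonglongrightarrow> 0"
    by (rule tendsto_norm_zero_cancel)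
  then show ?thesis
    using False by simp
qed

text \<open>The mean of the powers of \<open>\<mu> i / z\<close> tends to \<open>1\<close> when
  \<open>\<mu> i = z\<close> and to \<open>0\<close> otherwise, so the limit counts the indices of
  the first kind.\<close>

lemma cesaro_power_sums:
  fixes \<mu> :: "'a \<Rightarrow> complex"
  assumes "finite I" and "\<And>i. i \<in> I \<Longrightarrow> cmod (\<mu> i) \<le> 1" and "cmod z = 1"
  shows "(\<lambda>N. (\<Sum>k<N. (\<Sum>i\<in>I. \<mu> i ^ Suc k) / z ^ Suc k) / of_nat N)
           \<longlonglongrightarrow> of_nat (card {i \<in> I. \<mu> i = z})"
proof -
  have z: "z \<noteq> 0" using assms(3) by auto
  have "(\<lambda>N. \<Sum>i\<in>I. (\<Sum>k<N. (\<mu> i / z) ^ Suc k) / of_nat N)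
          \<longlonglongrightarrow> (\<Sum>i\<in>I. if \<mu> i / z = 1 then 1 else 0)"
    using assms by (intro tendsto_sum cesaro_powers) (auto simp: norm_divide)
  moreover have "(\<Sum>i\<in>I. (\<Sum>k<N. (\<mu> i / z) ^ Suc k) / of_nat N) =
      (\<Sum>k<N. (\<Sum>i\<in>I. \<mu> i ^ Suc k) / z ^ Suc k) / of_nat N" for N
    by (simp only: sum_divide_distrib power_divide) (rule sum.swap)
  moreover have "(\<Sum>i\<in>I. if \<mu> i / z = 1 then 1 else 0) = (of_nat (card {i \<in> I. \<mu> i = z}) :: complex)"
    using z assms(1) by (simp add: sum.inter_filter[symmetric])
  ultimately show ?thesis by simp
qed

text \<open>Nonnegative power sums force the multiplicity of a unimodular value to be at most that of
  \<open>1\<close>: both are Cesaro means, of the power sums twisted by a character and of the power sums.\<close>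

lemma nonneg_power_sums_card_le:
  fixes \<mu> :: "'a \<Rightarrow> complex"
  assumes "finite I" and "\<And>i. i \<in> I \<Longrightarrow> cmod (\<mu> i) \<le> 1" and "cmod z = 1"
    and nonneg: "\<And>k. \<exists>x\<ge>0. (\<Sum>i\<in>I. \<mu> i ^ Suc k) = complex_of_real x"
  shows "card {i \<in> I. \<mu> i = z} \<le> card {i \<in> I. \<mu> i = 1}"
proof -
  define c where "c k = (\<Sum>i\<in>I. \<mu> i ^ Suc k)" for k
  \<comment> \<open>Since \<open>c k\<close> is its own modulus, the triangle inequality bounds the
    sum twisted by \<open>z\<close> by the untwisted one, where no cancellation occurs.\<close>
  have c: "c k = complex_of_real (cmod (c k))" for k
    using nonneg[of k] by (auto simp: c_def)
  have "cmod ((\<Sum>k<N. c k / z ^ Suc k) / of_nat N) \<le> cmod ((\<Sum>k<N. c k / 1 ^ Suc k) / of_nat N)" for N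
  proof -
    have "cmod (\<Sum>k<N. c k / z ^ Suc k) \<le> (\<Sum>k<N. cmod (c k))"
      by (rule order_trans[OF norm_sum])
        (simp add: norm_divide norm_power norm_mult assms(3))
    also have "\<dots> = cmod (complex_of_real (\<Sum>k<N. cmod (c k)))"
      by (simp only: norm_of_real) (simp add: sum_nonneg)
    also have "complex_of_real (\<Sum>k<N. cmod (c k)) = (\<Sum>k<N. c k / 1 ^ Suc k)"
      by (simp add: c[symmetric])
    finally show ?thesis
      by (simp add: norm_divide divide_right_mono)
  qed
  moreover have "(\<lambda>N. cmod ((\<Sum>k<N. c k / w ^ Suc k) / of_nat N))
      \<longlonglongrightarrow> cmod (of_nat (card {i \<in> I. \<mu> i = w}))" if "cmod w = 1" for w
    unfolding c_def using assms(1,2) that by (intro tendsto_norm cesaro_power_sums)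
  ultimately have "cmod (of_nat (card {i \<in> I. \<mu> i = z})) \<le> cmod (of_nat (card {i \<in> I. \<mu> i = 1}))"
    using assms(3) by (intro LIMSEQ_le[of "\<lambda>N. cmod ((\<Sum>k<N. c k / z ^ Suc k) / of_nat N)" _
          "\<lambda>N. cmod ((\<Sum>k<N. c k / 1 ^ Suc k) / of_nat N)"]) (blast | simp only: norm_one)+
  then show ?thesis by simp
qed

subsection \<open>Traces and eigenvalues\<close>

lemma sum_diag_mult_commute:
  fixes A B :: "'a::comm_semiring_1 mat"
  assumes "A \<in> carrier_mat n m" "B \<in> carrier_mat m n"
  shows "(\<Sum>i<n. (A * B) $$ (i, i)) = (\<Sum>i<m. (B * A) $$ (i, i))"
proof -
  have "(\<Sum>i<n. (A * B) $$ (i, i)) = (\<Sum>i<n. \<Sum>j<m. A $$ (i, j) * B $$ (j, i))"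
    using assms by (simp add: scalar_prod_def atLeast0LessThan)
  also have "\<dots> = (\<Sum>j<m. \<Sum>i<n. B $$ (j, i) * A $$ (i, j))"
    by (subst sum.swap) (simp add: mult.commute)
  also have "\<dots> = (\<Sum>i<m. (B * A) $$ (i, i))"
    using assms by (simp add: scalar_prod_def atLeast0LessThan)
  finally show ?thesis .
qed

lemma upper_triangular_pow:
  fixes B :: "'a::comm_semiring_1 mat"
  assumes B: "B \<in> carrier_mat n n" and ut: "upper_triangular B"
  shows "(\<forall>i<n. \<forall>j<i. (B ^\<^sub>m k) $$ (i, j) = 0) \<and> (\<forall>i<n. (B ^\<^sub>m k) $$ (i, i) = B $$ (i, i) ^ k)"
proof (induction k)
  case 0
  then show ?case using B by auto
next
  case (Suc k)
  have pow: "B ^\<^sub>m k \<in> carrier_mat n n" using B by simp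
  have entry: "(B ^\<^sub>m Suc k) $$ (i, j) = (\<Sum>l<n. (B ^\<^sub>m k) $$ (i, l) * B $$ (l, j))" if "i < n" "j < n" for i j
    using B pow that by (simp add: scalar_prod_def atLeast0LessThan)
  have zero: "(B ^\<^sub>m k) $$ (i, l) * B $$ (l, j) = 0" if "i < n" "l < n" "j \<le> i" "l \<noteq> i \<or> l \<noteq> j" for i j l
  proof (cases "l < i")
    case True
    then show ?thesis using Suc that by simp
  next
    case False
    then have "j < l" using that by auto
    then show ?thesis using upper_triangularD[OF ut \<open>j < l\<close>] B that by simp
  qed
  have "(\<Sum>l<n. (B ^\<^sub>m k) $$ (i, l) * B $$ (l, i)) = (B ^\<^sub>m k) $$ (i, i) * B $$ (i, i)" if "i < n" for i
    using that zero[of i _ i] by (subst sum.remove[of _ i]) (auto intro!: sum.neutral)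
  then show ?case
    using Suc entry zero by (auto simp del: pow_mat.simps simp: mult.commute)
qed

text \<open>A Schur form with diagonal \<open>es\<close> stays triangular under powers, and
  cyclicity of the trace removes the change of basis.\<close>

lemma sum_diag_pow:
  fixes A :: "complex mat"
  assumes A: "A \<in> carrier_mat n n" and "eigenvalue_enumeration A es"
  shows "(\<Sum>i<n. (A ^\<^sub>m k) $$ (i, i)) = (\<Sum>i<n. es ! i ^ k)"
proof -
  obtain B P Q where "schur_decomposition A es = (B, P, Q)"
    by (cases "schur_decomposition A es") auto
  then have sim: "similar_mat_wit A B P Q" and ut: "upper_triangular B" and diag: "diag_mat B = es"
    using schur_decomposition[OF A] assms(2) by (auto simp: eigenvalue_enumeration_def)
  note S = similar_mat_witD2[OF A sim]
  have pow: "B ^\<^sub>m k \<in> carrier_mat n n" using S by simp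
  have "(\<Sum>i<n. (A ^\<^sub>m k) $$ (i, i)) = (\<Sum>i<n. (P * (B ^\<^sub>m k * Q)) $$ (i, i))"
    using similar_mat_wit_pow_id[OF sim, of k] S pow by (simp add: assoc_mult_mat[of _ n n _ n _ n])
  also have "\<dots> = (\<Sum>i<n. ((B ^\<^sub>m k * Q) * P) $$ (i, i))"
    using S pow by (intro sum_diag_mult_commute) auto
  also have "(B ^\<^sub>m k * Q) * P = B ^\<^sub>m k"
    using S pow by (simp add: assoc_mult_mat[of _ n n _ n _ n])
  also have "(\<Sum>i<n. (B ^\<^sub>m k) $$ (i, i)) = (\<Sum>i<n. es ! i ^ k)"
    using upper_triangular_pow[OF S(5) ut, of k] diag S(5) by (auto simp: diag_mat_def)
  finally show ?thesis .
qed

lemma eigenvalue_enumeration_exists: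
  fixes A :: "complex mat"
  assumes "A \<in> carrier_mat n n"
  shows "\<exists>es. eigenvalue_enumeration A es"
  using char_poly_factorized[OF assms] assms by (auto simp: eigenvalue_enumeration_def)

text \<open>Enumerations may be reordered freely: a repeated root can be moved to the front of a
  Schur diagonal, and eigenvalues can be sorted by modulus.\<close>

lemma eigenvalue_enumeration_mset:
  assumes "eigenvalue_enumeration A es" "mset es' = mset es"
  shows "eigenvalue_enumeration A es'"
proof -
  have "(\<Prod>e\<leftarrow>es'. [:- e, 1:]) = (\<Prod>e\<leftarrow>es. [:- e, 1:])"
    by (simp only: prod_mset_prod_list[symmetric] mset_map assms(2))
  then show ?thesis
    using assms(1) mset_eq_length[OF assms(2)] by (simp add: eigenvalue_enumeration_def)
qed

lemma order_char_poly_eq_count: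
  assumes "eigenvalue_enumeration A es"
  shows "Polynomial.order z (char_poly A) = count (mset es) z"
proof -
  have "Polynomial.order z (\<Prod>e\<leftarrow>es. [:- e, 1:]) = count (mset es) z"
  proof (induction es)
    case (Cons e es)
    have "(\<Prod>e\<leftarrow>e # es. [:- e, 1:]) \<noteq> 0"
      unfolding prod_list_zero_iff by auto
    then have nz: "[:- e, 1:] * (\<Prod>e\<leftarrow>es. [:- e, 1:]) \<noteq> 0"
      by (simp only: list.map prod_list.Cons not_False_eq_True)
    have "Polynomial.order z (\<Prod>e\<leftarrow>e # es. [:- e, 1:]) =
        Polynomial.order z [:- e, 1:] + Polynomial.order z (\<Prod>e\<leftarrow>es. [:- e, 1:])"
      by (simp only: list.map prod_list.Cons order_mult[OF nz])
    then show ?case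
      by (simp only: Cons order_linear') simp
  qed simp
  then show ?thesis
    using assms by (simp add: eigenvalue_enumeration_def)
qed

lemma spectrum_eq_set_enumeration:
  assumes "A \<in> carrier_mat n n" "eigenvalue_enumeration A es"
  shows "spectrum A = set es"
  using assms
  by (auto simp: spectrum_root_char_poly eigenvalue_enumeration_def poly_prod_list prod_list_zero_iff)

subsection \<open>Nonnegative irreducible matrices\<close>

text \<open>Functions on indices replace vectors, so that moduli, quotients and products can later
  be taken coordinate by coordinate.\<close>

lemma eigenvalue_iff_fun:
  fixes C :: "'a::comm_ring_1 mat"
  assumes C: "C \<in> carrier_mat n n"
  shows "eigenvalue C k \<longleftrightarrow>
    (\<exists>x. (\<exists>i<n. x i \<noteq> 0) \<and> (\<forall>i<n. (\<Sum>j<n. C $$ (i, j) * x j) = k * x i))"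
proof
  assume "eigenvalue C k"
  then obtain v where v: "v \<in> carrier_vec n" "v \<noteq> 0\<^sub>v n" "C *\<^sub>v v = k \<cdot>\<^sub>v v"
    using C by (auto simp: eigenvalue_def eigenvector_def)
  have "\<exists>i<n. v $ i \<noteq> 0"
    using v(1,2) by (metis carrier_vecD eq_vecI index_zero_vec(1) index_zero_vec(2))
  moreover have "(\<Sum>j<n. C $$ (i, j) * v $ j) = k * v $ i" if "i < n" for i
    using arg_cong[OF v(3), of "\<lambda>w. w $ i"] that C v(1)
    by (simp add: scalar_prod_def atLeast0LessThan)
  ultimately show "\<exists>x. (\<exists>i<n. x i \<noteq> 0) \<and> (\<forall>i<n. (\<Sum>j<n. C $$ (i, j) * x j) = k * x i)"
    by blast
next
  assume "\<exists>x. (\<exists>i<n. x i \<noteq> 0) \<and> (\<forall>i<n. (\<Sum>j<n. C $$ (i, j) * x j) = k * x i)"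
  then obtain x where x: "\<exists>i<n. x i \<noteq> 0" "\<And>i. i < n \<Longrightarrow> (\<Sum>j<n. C $$ (i, j) * x j) = k * x i"
    by blast
  have "C *\<^sub>v vec n x = k \<cdot>\<^sub>v vec n x"
    using C x(2) by (intro eq_vecI) (auto simp: scalar_prod_def atLeast0LessThan)
  moreover have "vec n x \<noteq> 0\<^sub>v n"
    using x(1) by (metis index_vec index_zero_vec(1))
  ultimately show "eigenvalue C k"
    using C unfolding eigenvalue_def eigenvector_def by (intro exI[of _ "vec n x"]) simp
qed

section \<open>Growth of powers and lower bounds for the spectral radius\<close>

text \<open>Nonnegativity of the powers is proved alongside because the induction step multiplies
  the inequality for \<open>w\<close> by entries of \<open>P ^\<^sub>m k\<close>.\<close>

lemma nonneg_pow_lower_bound: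
  fixes P :: "real mat" and w :: "nat \<Rightarrow> real"
  assumes P: "P \<in> carrier_mat n n"
    and nonneg: "\<And>i j. i < n \<Longrightarrow> j < n \<Longrightarrow> 0 \<le> P $$ (i, j)"
    and "0 \<le> q" and sub: "\<And>i. i < n \<Longrightarrow> q * w i \<le> (\<Sum>j<n. P $$ (i, j) * w j)"
  shows "(\<forall>i<n. \<forall>j<n. 0 \<le> (P ^\<^sub>m k) $$ (i, j)) \<and>
    (\<forall>i<n. q ^ k * w i \<le> (\<Sum>j<n. (P ^\<^sub>m k) $$ (i, j) * w j))"
proof (induction k)
  case 0
  have "(\<Sum>j<n. (1\<^sub>m n) $$ (i, j) * w j) = w i" if "i < n" for i
    using that by (subst sum.remove[of _ i]) auto
  then show ?case using P by auto
next
  case (Suc k)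
  have pow: "P ^\<^sub>m k \<in> carrier_mat n n" using P by simp
  have entry: "(P ^\<^sub>m Suc k) $$ (i, j) = (\<Sum>l<n. (P ^\<^sub>m k) $$ (i, l) * P $$ (l, j))"
    if "i < n" "j < n" for i j
    using P pow that by (simp add: scalar_prod_def atLeast0LessThan)
  have "q ^ Suc k * w i \<le> (\<Sum>j<n. (P ^\<^sub>m Suc k) $$ (i, j) * w j)" if i: "i < n" for i
  proof -
    have "q ^ Suc k * w i \<le> q * (\<Sum>l<n. (P ^\<^sub>m k) $$ (i, l) * w l)"
      using Suc i \<open>0 \<le> q\<close> by (simp add: mult.assoc mult_left_mono)
    also have "\<dots> = (\<Sum>l<n. (P ^\<^sub>m k) $$ (i, l) * (q * w l))"
      by (simp add: sum_distrib_left mult_ac)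
    also have "\<dots> \<le> (\<Sum>l<n. (P ^\<^sub>m k) $$ (i, l) * (\<Sum>j<n. P $$ (l, j) * w j))"
      using Suc i sub by (intro sum_mono mult_left_mono) auto
    also have "\<dots> = (\<Sum>j<n. \<Sum>l<n. (P ^\<^sub>m k) $$ (i, l) * P $$ (l, j) * w j)"
      by (subst sum.swap) (simp add: sum_distrib_left mult_ac)
    also have "\<dots> = (\<Sum>j<n. (P ^\<^sub>m Suc k) $$ (i, j) * w j)"
      using entry i by (simp add: sum_distrib_right del: pow_mat.simps)
    finally show ?thesis .
  qed
  moreover have "0 \<le> (P ^\<^sub>m Suc k) $$ (i, j)" if "i < n" "j < n" for i j
    unfolding entry[OF that] using Suc nonneg that by (intro sum_nonneg mult_nonneg_nonneg) auto
  ultimately show ?case by blast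
qed

lemma rho_nonneg:
  assumes "P \<in> carrier_mat n n" "0 < n"
  shows "0 \<le> rho P"
  using spectral_radius_mem_max(1)[of "complex_mat P" n] assms by auto

text \<open>A vector that grows at rate \<open>q\<close> bounds the spectral radius from below, because the powers
  of a matrix with spectral radius less than \<open>1\<close> are bounded.\<close>

lemma le_rho_if_subinvariant:
  fixes P :: "real mat" and w :: "nat \<Rightarrow> real"
  assumes P: "P \<in> carrier_mat n n"
    and nonneg: "\<And>i j. i < n \<Longrightarrow> j < n \<Longrightarrow> 0 \<le> P $$ (i, j)"
    and w: "\<And>i. i < n \<Longrightarrow> 0 \<le> w i" and i0: "i0 < n" "0 < w i0"
    and sub: "\<And>i. i < n \<Longrightarrow> q * w i \<le> (\<Sum>j<n. P $$ (i, j) * w j)"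
  shows "q \<le> rho P"
proof (rule ccontr)
  assume "\<not> q \<le> rho P"
  \<comment> \<open>With \<open>r\<close> strictly in between, \<open>P / r\<close> has spectral
    radius below \<open>1\<close> while \<open>w\<close> still grows at rate
    \<open>q / r > 1\<close>.\<close>
  then obtain r where r: "rho P < r" "r < q"
    using dense[of "rho P" q] by auto
  have n: "0 < n" using i0 by auto
  have r0: "0 < r" using rho_nonneg[OF P n] r by simp
  define R where "R = (1 / r) \<cdot>\<^sub>m P"
  have R: "R \<in> carrier_mat n n" using P by (simp add: R_def)
  have CR: "complex_mat R \<in> carrier_mat n n" and CP: "complex_mat P \<in> carrier_mat n n"
    using P R by simp_all
  have entryR: "R $$ (i, j) = P $$ (i, j) / r" if "i < n" "j < n" for i j
    using P that by (simp add: R_def)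
  have "eigenvalue (complex_mat P) (complex_of_real r * z)" if ev: "eigenvalue (complex_mat R) z" for z
  proof -
    obtain x where x: "\<exists>i<n. x i \<noteq> 0"
      "\<And>i. i < n \<Longrightarrow> (\<Sum>j<n. complex_mat R $$ (i, j) * x j) = z * x i"
      using ev unfolding eigenvalue_iff_fun[OF CR] by blast
    have "(\<Sum>j<n. complex_mat P $$ (i, j) * x j) = of_real r * z * x i" if "i < n" for i
    proof -
      have "(\<Sum>j<n. complex_mat P $$ (i, j) * x j) = of_real r * (\<Sum>j<n. complex_mat R $$ (i, j) * x j)"
        unfolding sum_distrib_left using P R r0 that by (intro sum.cong) (auto simp: entryR)
      then show ?thesis using x(2)[OF that] by simp
    qed
    then show ?thesis
      using x(1) unfolding eigenvalue_iff_fun[OF CP] by blast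
  qed
  then have "r * cmod z \<le> rho P" if "z \<in> spectrum (complex_mat R)" for z
    using spectral_radius_mem_max(2)[of "complex_mat P" n "cmod (complex_of_real r * z)"] P n that r0
    by (force simp: spectrum_def norm_mult)
  then have "r * cmod z < r * 1" if "z \<in> spectrum (complex_mat R)" for z
    using that r(1) by fastforce
  then have "cmod z < 1" if "z \<in> spectrum (complex_mat R)" for z
    using that r0 by (simp only: mult_less_cancel_left_pos)
  then have "spectral_radius (complex_mat R) < 1"
    using spectral_radius_mem_max(1)[of "complex_mat R" n] R n by auto
  then obtain c where c: "\<And>k. norm_bound (complex_mat R ^\<^sub>m k) c"
    using spectral_radius_jnf_norm_bound_less_1_upper_triangular[of "complex_mat R" n] R by auto
  have R0: "0 \<le> R $$ (i, j)" if "i < n" "j < n" for i j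
    using entryR[OF that] nonneg[OF that] r0 by simp
  have subR: "q / r * w i \<le> (\<Sum>j<n. R $$ (i, j) * w j)" if "i < n" for i
  proof -
    have "(\<Sum>j<n. R $$ (i, j) * w j) = (\<Sum>j<n. P $$ (i, j) * w j) / r"
      using that by (simp add: entryR sum_divide_distrib)
    then show ?thesis using sub[OF that] r0 by (simp add: divide_right_mono)
  qed
  have q: "1 < q / r" using r r0 by simp
  have "(q / r) ^ k \<le> c * (\<Sum>j<n. w j) / w i0" for k
  proof -
    have bnd: "(R ^\<^sub>m k) $$ (i0, j) \<le> c" if "j < n" for j
    proof -
      have "complex_mat R ^\<^sub>m k = complex_mat (R ^\<^sub>m k)"
        using R by (simp add: of_real_hom.mat_hom_pow)
      then have "cmod (complex_of_real ((R ^\<^sub>m k) $$ (i0, j))) \<le> c"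
        using c[of k] R i0 that by (auto simp: norm_bound_def)
      then show ?thesis by simp
    qed
    have "(q / r) ^ k * w i0 \<le> (\<Sum>j<n. (R ^\<^sub>m k) $$ (i0, j) * w j)"
      using nonneg_pow_lower_bound[OF R R0 _ subR, of k] q i0 by simp
    also have "\<dots> \<le> (\<Sum>j<n. c * w j)"
      using bnd w by (intro sum_mono mult_right_mono) auto
    finally show ?thesis
      using i0 by (simp add: sum_distrib_left pos_le_divide_eq)
  qed
  then show False
    using real_arch_pow[OF q] by (meson not_less)
qed

section \<open>Perron vectors of nonnegative irreducible matrices\<close>

text \<open>Irreducibility is read off the directed graph of nonzero entries: an edge leaves every
  proper nonempty set of indices.\<close>

locale nonneg_irreducible =
  fixes n :: nat and P :: "real mat"
  assumes n: "2 \<le> n" and carrier: "P \<in> carrier_mat n n"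
    and nonneg: "\<And>i j. i < n \<Longrightarrow> j < n \<Longrightarrow> 0 \<le> P $$ (i, j)"
    and edge: "\<And>K. K \<subseteq> {..<n} \<Longrightarrow> K \<noteq> {} \<Longrightarrow> K \<noteq> {..<n} \<Longrightarrow>
      \<exists>i\<in>K. \<exists>j\<in>{..<n} - K. P $$ (i, j) \<noteq> 0"
begin

abbreviation r where "r \<equiv> rho P"

lemma n_pos: "0 < n"
  using n by simp

lemma complex_carrier: "complex_mat P \<in> carrier_mat n n"
  using carrier by simp

lemma edge_into:
  assumes "K \<subseteq> {..<n}" "K \<noteq> {}" "K \<noteq> {..<n}"
  shows "\<exists>i\<in>{..<n} - K. \<exists>j\<in>K. P $$ (i, j) \<noteq> 0"
proof -
  have "{..<n} - K \<noteq> {}" "{..<n} - K \<noteq> {..<n}" using assms by auto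
  then show ?thesis using edge[of "{..<n} - K"] by auto
qed

text \<open>At a zero coordinate every term of the sum vanishes, so no edge leaves the zero set of
  \<open>y\<close>, against \<open>edge\<close>.\<close>

lemma nonneg_eigenvector_pos:
  fixes y :: "nat \<Rightarrow> real"
  assumes y: "\<And>i. i < n \<Longrightarrow> 0 \<le> y i" and "\<exists>i<n. y i \<noteq> 0"
    and eq: "\<And>i. i < n \<Longrightarrow> (\<Sum>j<n. P $$ (i, j) * y j) = k * y i"
  shows "\<forall>i<n. 0 < y i"
proof (rule ccontr)
  assume "\<not> (\<forall>i<n. 0 < y i)"
  then have "{i. i < n \<and> y i = 0} \<noteq> {}" using y by force
  moreover have "{i. i < n \<and> y i = 0} \<noteq> {..<n}" using assms(2) by auto
  ultimately obtain i j where ij: "i < n" "y i = 0" "j < n" "y j \<noteq> 0" "P $$ (i, j) \<noteq> 0"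
    using edge[of "{i. i < n \<and> y i = 0}"] by auto
  have "(\<Sum>j<n. P $$ (i, j) * y j) = 0"
    using eq[OF ij(1)] ij(2) by simp
  then have "P $$ (i, j) * y j = 0"
    using ij y nonneg by (subst (asm) sum_nonneg_eq_0_iff) auto
  then show False using ij by simp
qed

text \<open>If a vector with \<open>P y \<ge> r y\<close> were strict somewhere, then applying \<open>1 + P\<close> would make more
  and more coordinates strict; once all are strict, the spectral radius exceeds \<open>r\<close>.\<close>

lemma subinvariant_imp_invariant:
  fixes y :: "nat \<Rightarrow> real"
  assumes y: "\<And>i. i < n \<Longrightarrow> 0 \<le> y i"
    and sub: "\<And>i. i < n \<Longrightarrow> r * y i \<le> (\<Sum>j<n. P $$ (i, j) * y j)"
    and "i < n"
  shows "(\<Sum>j<n. P $$ (i, j) * y j) = r * y i"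
proof -
  have "{i. i < n \<and> r * y i < (\<Sum>j<n. P $$ (i, j) * y j)} = {}"
    using y sub
  proof (induction "n - card {i. i < n \<and> r * y i < (\<Sum>j<n. P $$ (i, j) * y j)}" arbitrary: y rule: less_induct)
    case (less y)
    define S where "S y = {i. i < n \<and> r * y i < (\<Sum>j<n. P $$ (i, j) * y j)}" for y
    show ?case
    proof (rule ccontr)
      assume "{i. i < n \<and> r * y i < (\<Sum>j<n. P $$ (i, j) * y j)} \<noteq> {}"
      then have ne: "S y \<noteq> {}" by (simp add: S_def)
      have sub: "S y \<subseteq> {..<n}" by (auto simp: S_def)
      show False
      proof (cases "S y = {..<n}")
        case True
        \<comment> \<open>The denominator \<open>y i + 1\<close> is positive even where
          \<open>y i\<close> vanishes, and it exceeds \<open>y i\<close>, so an extra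
          \<open>e * y i\<close> fits into the slack at \<open>i\<close>.\<close>
        define gap where "gap i = ((\<Sum>j<n. P $$ (i, j) * y j) - r * y i) / (y i + 1)" for i
        define e where "e = Min (gap ` {..<n})"
        have strict: "r * y i < (\<Sum>j<n. P $$ (i, j) * y j)" if "i < n" for i
        proof -
          have "i \<in> S y" using True that by simp
          then show ?thesis by (simp add: S_def)
        qed
        have gap: "0 < gap i" if "i < n" for i
          unfolding gap_def using strict[OF that] less(2)[OF that] by (intro divide_pos_pos) simp_all
        have e: "0 < e" unfolding e_def using n_pos gap by (subst Min_gr_iff) auto
        have "(r + e) * y i \<le> (\<Sum>j<n. P $$ (i, j) * y j)" if "i < n" for i
        proof -
          have "e \<le> gap i" using that by (auto simp: e_def)
          then have "e * (y i + 1) \<le> (\<Sum>j<n. P $$ (i, j) * y j) - r * y i"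
            using less(2)[OF that] by (simp add: gap_def pos_le_divide_eq)
          then show ?thesis using e by (simp add: algebra_simps)
        qed
        moreover obtain i0 where "i0 < n" "0 < y i0"
        proof -
          have "(\<Sum>j<n. P $$ (0, j) * y j) \<noteq> 0"
            using strict[OF n_pos] mult_nonneg_nonneg[OF rho_nonneg[OF carrier n_pos] less(2)[OF n_pos]]
            by linarith
          then obtain j where "j \<in> {..<n}" "P $$ (0, j) * y j \<noteq> 0"
            by (rule sum.not_neutral_contains_not_neutral)
          then show ?thesis using less(2)[of j] that[of j] by auto
        qed
        ultimately have "r + e \<le> r"
          by (intro le_rho_if_subinvariant[where w = y, OF carrier nonneg less(2)])
        then show False using e by simp
      next
        case False
        define z where "z i = y i + (\<Sum>j<n. P $$ (i, j) * y j)" for i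
        have z0: "0 \<le> z i" if "i < n" for i
          using less(2) nonneg that by (auto simp: z_def intro!: add_nonneg_nonneg sum_nonneg)
        define d where "d i = (\<Sum>j<n. P $$ (i, j) * y j) - r * y i" for i
        have d: "0 \<le> d i" if "i < n" for i using less(3)[OF that] by (simp add: d_def)
        have dS: "i \<in> S y \<longleftrightarrow> i < n \<and> 0 < d i" for i by (auto simp: S_def d_def)
        \<comment> \<open>The slack of \<open>(1 + P) y\<close> is \<open>(1 + P) d\<close>, as
          \<open>P\<close> commutes with \<open>1 + P\<close>; strictness therefore persists and
          spreads backwards along edges.\<close>
        have dz: "(\<Sum>j<n. P $$ (i, j) * z j) - r * z i = d i + (\<Sum>j<n. P $$ (i, j) * d j)" for i
          by (simp add: d_def z_def algebra_simps sum.distrib sum_subtractf sum_distrib_left)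
        have Pd: "0 \<le> P $$ (i, j) * d j" if "i < n" "j < n" for i j
          using nonneg d that by simp
        have sz: "r * z i \<le> (\<Sum>j<n. P $$ (i, j) * z j)" if "i < n" for i
          using dz[of i] d[OF that] sum_nonneg[of "{..<n}" "\<lambda>j. P $$ (i, j) * d j"] Pd[OF that] by simp
        have "S y \<subseteq> S z"
        proof
          fix i assume i: "i \<in> S y"
          then have "i < n" "0 < d i" by (auto simp: dS)
          then show "i \<in> S z"
            using dz[of i] sum_nonneg[of "{..<n}" "\<lambda>j. P $$ (i, j) * d j"] Pd[of i] by (simp add: S_def)
        qed
        moreover obtain i j where ij: "i < n" "i \<notin> S y" "j \<in> S y" "P $$ (i, j) \<noteq> 0"
          using edge_into[OF sub ne False] by auto
        have "0 < P $$ (i, j) * d j"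
          using ij nonneg[of i j] sub by (auto simp: dS)
        then have "0 < (\<Sum>j<n. P $$ (i, j) * d j)"
          using ij Pd sub by (intro sum_pos2[of _ j]) auto
        then have "i \<in> S z"
          using dz[of i] d[of i] ij by (simp add: S_def)
        ultimately have psub: "S y \<subset> S z" using ij by blast
        have fin: "finite (S z)" and le: "card (S z) \<le> n"
          using card_mono[of "{..<n}" "S z"] by (auto simp: S_def)
        have "card (S y) < card (S z)" by (rule psubset_card_mono[OF fin psub])
        then have "n - card (S z) < n - card (S y)" using le by simp
        then have "S z = {}"
          using less(1)[of z] z0 sz unfolding S_def by blast
        then show False using psub by blast
      qed
    qed
  qed
  then have "i \<notin> {i. i < n \<and> r * y i < (\<Sum>j<n. P $$ (i, j) * y j)}" by simp
  then show ?thesis using assms(2)[OF \<open>i < n\<close>] \<open>i < n\<close> by simp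
qed

text \<open>The triangle inequality makes the moduli subinvariant, hence invariant; positivity then
  comes from irreducibility.\<close>

lemma abs_peripheral_eigenvector:
  fixes x :: "nat \<Rightarrow> complex"
  assumes "\<exists>i<n. x i \<noteq> 0" "cmod z = r"
    and x: "\<And>i. i < n \<Longrightarrow> (\<Sum>j<n. complex_of_real (P $$ (i, j)) * x j) = z * x i"
  shows "\<forall>i<n. (\<Sum>j<n. P $$ (i, j) * cmod (x j)) = r * cmod (x i)" and "\<forall>i<n. 0 < cmod (x i)"
proof -
  have "r * cmod (x i) \<le> (\<Sum>j<n. P $$ (i, j) * cmod (x j))" if "i < n" for i
  proof -
    have "r * cmod (x i) = cmod (\<Sum>j<n. complex_of_real (P $$ (i, j)) * x j)"
      using x[OF that] assms(2) by (simp add: norm_mult)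
    also have "\<dots> \<le> (\<Sum>j<n. P $$ (i, j) * cmod (x j))"
      using nonneg[OF that] by (intro order_trans[OF norm_sum] sum_mono) (auto simp: norm_mult)
    finally show ?thesis .
  qed
  then show eq: "\<forall>i<n. (\<Sum>j<n. P $$ (i, j) * cmod (x j)) = r * cmod (x i)"
    using subinvariant_imp_invariant[of "\<lambda>i. cmod (x i)"] by simp
  show "\<forall>i<n. 0 < cmod (x i)"
    using nonneg_eigenvector_pos[of "\<lambda>i. cmod (x i)" r] eq assms(1) by auto
qed

text \<open>The spectral radius is attained by some eigenvalue, and the moduli of its eigenvector
  serve as \<open>v\<close>.\<close>

lemma perron_vector:
  obtains v :: "nat \<Rightarrow> real"
  where "\<forall>i<n. 0 < v i" "\<forall>i<n. (\<Sum>j<n. P $$ (i, j) * v j) = r * v i"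
proof -
  obtain z where "eigenvalue (complex_mat P) z" "cmod z = r"
    using spectral_radius_mem_max(1)[OF complex_carrier n_pos] by (auto simp: spectrum_def)
  then obtain x where "\<exists>i<n. x i \<noteq> 0"
    "\<And>i. i < n \<Longrightarrow> (\<Sum>j<n. complex_of_real (P $$ (i, j)) * x j) = z * x i"
    using carrier by (auto simp: eigenvalue_iff_fun[OF complex_carrier])
  from abs_peripheral_eigenvector[OF this(1) \<open>cmod z = r\<close> this(2)] show ?thesis
    by (rule that[rotated])
qed

text \<open>Here \<open>2 \<le> n\<close> matters, since the zero matrix of size one is irreducible:
  an edge leaves \<open>{0}\<close>, which makes \<open>P v\<close> positive at
  \<open>0\<close>.\<close>

lemma r_pos: "0 < r"
proof -
  obtain v where v: "\<forall>i<n. 0 < v i" "\<forall>i<n. (\<Sum>j<n. P $$ (i, j) * v j) = r * v i"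
    by (rule perron_vector)
  have "1 \<in> {..<n}" using n by simp
  then have "{0} \<noteq> {..<n}" by (metis singletonD zero_neq_one)
  then obtain j where j: "j < n" "P $$ (0, j) \<noteq> 0"
    using edge[of "{0}"] n_pos by auto
  have "0 < (\<Sum>j<n. P $$ (0, j) * v j)"
  proof (rule sum_pos2[of _ j])
    show "0 < P $$ (0, j) * v j"
      using j v(1) nonneg[OF n_pos j(1)] by simp
    show "0 \<le> P $$ (0, i) * v i" if "i \<in> {..<n}" for i
      using that v(1) nonneg[OF n_pos, of i] by (simp add: less_imp_le)
  qed (use j in auto)
  then have "0 < r * v 0" using v(2) n_pos by simp
  moreover have "0 < v 0" using v(1) n_pos by blast
  ultimately show ?thesis by (rule zero_less_mult_pos2)
qed

lemma eigenvalue_r: "eigenvalue (complex_mat P) (complex_of_real r)"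
proof -
  obtain v where v: "\<forall>i<n. 0 < v i" "\<forall>i<n. (\<Sum>j<n. P $$ (i, j) * v j) = r * v i"
    by (rule perron_vector)
  have "(\<Sum>j<n. complex_mat P $$ (i, j) * complex_of_real (v j)) = complex_of_real r * complex_of_real (v i)"
    if "i < n" for i
  proof -
    have "(\<Sum>j<n. complex_mat P $$ (i, j) * complex_of_real (v j)) = complex_of_real (\<Sum>j<n. P $$ (i, j) * v j)"
      using that carrier by simp
    then show ?thesis using v that by simp
  qed
  then show ?thesis
    unfolding eigenvalue_iff_fun[OF complex_carrier] using v(1) n_pos
    by (intro exI[of _ "\<lambda>i. complex_of_real (v i)"]) force
qed


lemma transpose: "nonneg_irreducible n (transpose_mat P)"
proof
  show "\<exists>i\<in>K. \<exists>j\<in>{..<n} - K. transpose_mat P $$ (i, j) \<noteq> 0"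
    if K: "K \<subseteq> {..<n}" "K \<noteq> {}" "K \<noteq> {..<n}" for K
  proof -
    obtain i j where "i \<in> {..<n} - K" "j \<in> K" "P $$ (i, j) \<noteq> 0"
      using edge_into[OF K] by blast
    then have "transpose_mat P $$ (j, i) \<noteq> 0" using carrier K by auto
    then show ?thesis using \<open>i \<in> {..<n} - K\<close> \<open>j \<in> K\<close> by blast
  qed
qed (use n carrier nonneg in auto)

section \<open>Peripheral eigenvalues as phases along edges\<close>

text \<open>Equality in the triangle inequality forces the coordinates reached by edges from
  \<open>i\<close> to share one phase. The eigenvalue equation thus becomes a condition on single
  edges.\<close>

lemma peripheral_phase:
  assumes "eigenvalue (complex_mat P) z" "cmod z = r"
  obtains u :: "nat \<Rightarrow> complex"
  where "\<And>i. i < n \<Longrightarrow> cmod (u i) = 1"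
    and "\<And>i j. i < n \<Longrightarrow> j < n \<Longrightarrow> P $$ (i, j) \<noteq> 0 \<Longrightarrow> complex_of_real r * u j = z * u i"
proof -
  obtain x where x0: "\<exists>i<n. x i \<noteq> 0"
    and x: "\<And>i. i < n \<Longrightarrow> (\<Sum>j<n. complex_of_real (P $$ (i, j)) * x j) = z * x i"
    using assms(1) carrier by (auto simp: eigenvalue_iff_fun[OF complex_carrier])
  define m where "m i = cmod (x i)" for i
  have ev: "\<forall>i<n. (\<Sum>j<n. P $$ (i, j) * m j) = r * m i" "\<forall>i<n. 0 < m i"
    using abs_peripheral_eigenvector[OF x0 assms(2) x] by (simp_all add: m_def)
  define u where "u i = x i / complex_of_real (m i)" for i
  have u: "cmod (u i) = 1" if "i < n" for i
    using ev(2) that by (auto simp: u_def norm_divide m_def)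
  have xu: "x i = complex_of_real (m i) * u i" if "i < n" for i
    using ev(2) that by (auto simp: u_def)
  have z: "z \<noteq> 0" using assms(2) r_pos by auto
  have phase: "complex_of_real r * u j = z * u i" if i: "i < n" and j: "j < n" "P $$ (i, j) \<noteq> 0" for i j
  proof -
    have ui: "u i \<noteq> 0" using u[OF i] by auto
    \<comment> \<open>The claim amounts to \<open>t j = 1\<close>. The weighted sum of these
      unimodular numbers equals the total weight, so every term of positive weight has real part
      \<open>1\<close>.\<close>
    define t where "t j = complex_of_real r * u j / (z * u i)" for j
    have t: "cmod (t j) = 1" if "j < n" for j
      using u[OF that] u[OF i] assms(2) r_pos by (simp add: t_def norm_mult norm_divide)
    have "(\<Sum>j<n. complex_of_real (P $$ (i, j) * m j) * t j) =
        (\<Sum>j<n. complex_of_real (P $$ (i, j)) * x j) * (complex_of_real r / (z * u i))"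
      unfolding sum_distrib_right by (intro sum.cong refl) (simp add: xu t_def)
    also have "\<dots> = complex_of_real (r * m i)"
      using x[OF i] xu[OF i] ui z by (simp add: field_simps)
    also have "r * m i = (\<Sum>j<n. P $$ (i, j) * m j)"
      using ev(1) i by simp
    finally have "Re (\<Sum>j<n. complex_of_real (P $$ (i, j) * m j) * t j) = (\<Sum>j<n. P $$ (i, j) * m j)"
      by (simp only: Re_complex_of_real)
    then have "(\<Sum>j<n. P $$ (i, j) * m j * (1 - Re (t j))) = 0"
      by (simp add: right_diff_distrib sum_subtractf)
    moreover have "0 \<le> P $$ (i, j) * m j * (1 - Re (t j))" if "j < n" for j
      using nonneg[OF i that] ev(2) that complex_Re_le_cmod[of "t j"] t[OF that]
      by (intro mult_nonneg_nonneg) (auto simp: less_imp_le)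
    ultimately have "P $$ (i, j) * m j * (1 - Re (t j)) = 0"
      using j by (subst (asm) sum_nonneg_eq_0_iff) auto
    then have "Re (t j) = 1" using j ev(2) by auto
    then have "t j = 1" using t[OF j(1)] by (simp add: complex_eq_iff cmod_def)
    then show ?thesis using ui z by (simp add: t_def)
  qed
  show ?thesis by (rule that[OF u phase])
qed

text \<open>The Perron vector twisted by the phases is an eigenvector, which reverses the passage
  from eigenvalues to phases.\<close>

lemma eigenvalue_if_phase:
  assumes u: "\<And>i. i < n \<Longrightarrow> cmod (u i) = 1"
    and phase: "\<And>i j. i < n \<Longrightarrow> j < n \<Longrightarrow> P $$ (i, j) \<noteq> 0 \<Longrightarrow> complex_of_real r * u j = z * u i"
  shows "eigenvalue (complex_mat P) z"
proof -
  obtain v where v: "\<forall>i<n. 0 < v i" "\<forall>i<n. (\<Sum>j<n. P $$ (i, j) * v j) = r * v i"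
    by (rule perron_vector)
  have "(\<Sum>j<n. complex_mat P $$ (i, j) * (complex_of_real (v j) * u j)) = z * (complex_of_real (v i) * u i)"
    if i: "i < n" for i
  proof -
    have "complex_of_real r * (\<Sum>j<n. complex_mat P $$ (i, j) * (complex_of_real (v j) * u j)) =
        (\<Sum>j<n. complex_of_real (P $$ (i, j) * v j) * (z * u i))"
      unfolding sum_distrib_left
    proof (intro sum.cong refl)
      fix j assume "j \<in> {..<n}"
      then show "complex_of_real r * (complex_mat P $$ (i, j) * (complex_of_real (v j) * u j)) =
          complex_of_real (P $$ (i, j) * v j) * (z * u i)"
        using phase[OF i, of j] carrier i by (cases "P $$ (i, j) = 0") (auto simp: mult_ac)
    qed
    also have "\<dots> = complex_of_real (r * v i) * (z * u i)"
      using v i by (simp add: sum_distrib_right[symmetric] del: of_real_mult flip: of_real_sum)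
    finally show ?thesis using r_pos by simp
  qed
  moreover have "complex_of_real (v 0) * u 0 \<noteq> 0"
    using v(1) u[OF n_pos] n_pos by auto
  ultimately show ?thesis
    unfolding eigenvalue_iff_fun[OF complex_carrier] using n_pos
    by (intro exI[of _ "\<lambda>j. complex_of_real (v j) * u j"]) auto
qed

lemma peripheral_spectrum_eq:
  "peripheral_spectrum (complex_mat P) = {z. eigenvalue (complex_mat P) z \<and> cmod z = r}"
  by (auto simp: peripheral_spectrum_def spectrum_def)

lemma finite_peripheral: "finite (peripheral_spectrum (complex_mat P))"
  using card_finite_spectrum(1)[OF complex_carrier] by (simp add: peripheral_spectrum_def)

lemma r_peripheral: "complex_of_real r \<in> peripheral_spectrum (complex_mat P)"
  using eigenvalue_r r_pos by (simp add: peripheral_spectrum_eq)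

text \<open>The coordinatewise product of two phase functions satisfies the edge condition for
  \<open>z * w / r\<close>.\<close>

lemma peripheral_mult:
  assumes "z \<in> peripheral_spectrum (complex_mat P)" "w \<in> peripheral_spectrum (complex_mat P)"
  shows "z * w / complex_of_real r \<in> peripheral_spectrum (complex_mat P)"
proof -
  obtain u where u: "\<And>i. i < n \<Longrightarrow> cmod (u i) = 1"
    "\<And>i j. i < n \<Longrightarrow> j < n \<Longrightarrow> P $$ (i, j) \<noteq> 0 \<Longrightarrow> complex_of_real r * u j = z * u i"
    using assms(1) peripheral_phase unfolding peripheral_spectrum_eq by blast
  obtain u' where u': "\<And>i. i < n \<Longrightarrow> cmod (u' i) = 1"
    "\<And>i j. i < n \<Longrightarrow> j < n \<Longrightarrow> P $$ (i, j) \<noteq> 0 \<Longrightarrow> complex_of_real r * u' j = w * u' i"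
    using assms(2) peripheral_phase unfolding peripheral_spectrum_eq by blast
  have "complex_of_real r * (u j * u' j) = z * w / complex_of_real r * (u i * u' i)"
    if "i < n" "j < n" "P $$ (i, j) \<noteq> 0" for i j
  proof -
    have "complex_of_real r * (complex_of_real r * (u j * u' j)) = (z * u i) * (w * u' i)"
      unfolding u(2)[OF that, symmetric] u'(2)[OF that, symmetric] by (simp only: mult_ac)
    then show ?thesis using r_pos by (simp add: field_simps)
  qed
  then have "eigenvalue (complex_mat P) (z * w / complex_of_real r)"
    using u(1) u'(1) by (intro eigenvalue_if_phase[of "\<lambda>i. u i * u' i"]) (auto simp: norm_mult)
  then show ?thesis
    using assms r_pos by (auto simp: peripheral_spectrum_eq norm_mult norm_divide)
qed

lemma card_peripheral_pos: "0 < card (peripheral_spectrum (complex_mat P))"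
  using finite_peripheral r_peripheral by (auto simp: card_gt_0_iff)

text \<open>Scaled to the unit circle, the peripheral spectrum is a finite set closed under
  multiplication, hence a group of roots of unity.\<close>

lemma peripheral_spectrum_roots:
  defines "k \<equiv> card (peripheral_spectrum (complex_mat P))"
  shows "peripheral_spectrum (complex_mat P) = {z. z ^ k = complex_of_real (r ^ k)}"
proof (rule card_subset_eq)
  let ?G = "peripheral_spectrum (complex_mat P)"
  have G0: "z \<noteq> 0" if "z \<in> ?G" for z using that r_pos by (auto simp: peripheral_spectrum_eq)
  show "?G \<subseteq> {z. z ^ k = complex_of_real (r ^ k)}"
  proof
    fix z assume z: "z \<in> ?G"
    let ?f = "\<lambda>w. z * w / complex_of_real r"
    have inj: "inj_on ?f ?G" using r_pos G0[OF z] by (intro inj_onI) auto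
    \<comment> \<open>Multiplication by \<open>z / r\<close> permutes the finite set, so comparing
      the products of all elements gives \<open>(z / r) ^ k = 1\<close>.\<close>
    have "?f ` ?G = ?G"
      using peripheral_mult[OF z] by (intro card_subset_eq[OF finite_peripheral] card_image[OF inj]) auto
    then have "(\<Prod>w\<in>?G. w) = (\<Prod>w\<in>?G. ?f w)"
      using prod.reindex[OF inj, of "\<lambda>w. w"] by simp
    also have "\<dots> = (z / complex_of_real r) ^ k * (\<Prod>w\<in>?G. w)"
      unfolding k_def by (simp only: prod_constant[symmetric] prod.distrib[symmetric]) simp
    finally have "(z / complex_of_real r) ^ k = 1"
      using G0 finite_peripheral by (auto simp: prod_zero_iff)
    then show "z \<in> {z. z ^ k = complex_of_real (r ^ k)}"
      using r_pos by (simp add: power_divide)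
  qed
  show "finite {z. z ^ k = complex_of_real (r ^ k)}"
    using card_peripheral_pos by (intro finite_nth_roots) (simp add: k_def)
  show "card ?G = card {z. z ^ k = complex_of_real (r ^ k)}"
    using card_peripheral_pos r_pos by (subst card_nth_roots) (simp_all add: k_def)
qed

text \<open>A loop at \<open>i\<close> turns the edge condition into
  \<open>r * u i = z * u i\<close> with \<open>u i\<close> nonzero.\<close>

lemma peripheral_spectrum_if_diag:
  assumes "i < n" "P $$ (i, i) \<noteq> 0"
  shows "peripheral_spectrum (complex_mat P) = {complex_of_real r}"
proof -
  have "z = complex_of_real r" if "z \<in> peripheral_spectrum (complex_mat P)" for z
  proof -
    obtain u where "\<And>i. i < n \<Longrightarrow> cmod (u i) = 1"
      "\<And>i j. i < n \<Longrightarrow> j < n \<Longrightarrow> P $$ (i, j) \<noteq> 0 \<Longrightarrow> complex_of_real r * u j = z * u i"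
      using \<open>z \<in> _\<close> peripheral_phase unfolding peripheral_spectrum_eq by blast
    from this(1)[OF assms(1)] this(2)[OF assms(1,1,2)] show ?thesis by auto
  qed
  then show ?thesis using r_peripheral by blast
qed

section \<open>Algebraic simplicity of the Perron root\<close>

text \<open>Subtracting the multiple of \<open>v\<close> that agrees with \<open>x\<close> at index
  \<open>0\<close> leaves a solution with a zero coordinate, whereas eigenvectors for
  \<open>r\<close> have none.\<close>

lemma kernel_one_dim:
  fixes x :: "nat \<Rightarrow> complex"
  assumes v: "\<forall>i<n. 0 < v i" "\<forall>i<n. (\<Sum>j<n. P $$ (i, j) * v j) = r * v i"
    and x: "\<And>i. i < n \<Longrightarrow> (\<Sum>j<n. complex_of_real (P $$ (i, j)) * x j) = complex_of_real r * x i"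
  obtains c where "\<And>i. i < n \<Longrightarrow> x i = c * complex_of_real (v i)"
proof -
  define c where "c = x 0 / complex_of_real (v 0)"
  define y where "y i = x i - c * complex_of_real (v i)" for i
  have "(\<Sum>j<n. complex_of_real (P $$ (i, j)) * y j) = complex_of_real r * y i" if i: "i < n" for i
  proof -
    have "(\<Sum>j<n. complex_of_real (P $$ (i, j)) * y j) =
        (\<Sum>j<n. complex_of_real (P $$ (i, j)) * x j) - c * complex_of_real (\<Sum>j<n. P $$ (i, j) * v j)"
      by (simp add: y_def algebra_simps sum_subtractf sum_distrib_left)
    also have "\<dots> = complex_of_real r * x i - c * complex_of_real (r * v i)"
      using v(2) x[OF i] i by simp
    finally show ?thesis by (simp add: y_def algebra_simps)
  qed
  moreover have "cmod (complex_of_real r) = r" using r_pos by simp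
  moreover have "y 0 = 0" using v(1) n_pos by (auto simp: y_def c_def)
  ultimately have "\<not> (\<exists>i<n. y i \<noteq> 0)"
    using abs_peripheral_eigenvector(2)[of y "complex_of_real r"] n_pos by auto
  then show ?thesis by (intro that[of c]) (simp add: y_def)
qed

text \<open>This is the Perron vector of the transpose; pairing it with a right Perron vector
  identifies the two spectral radii.\<close>

lemma left_perron_vector:
  obtains u :: "nat \<Rightarrow> real"
  where "\<forall>i<n. 0 < u i" "\<forall>j<n. (\<Sum>i<n. u i * P $$ (i, j)) = r * u j"
proof -
  interpret T: nonneg_irreducible n "transpose_mat P" by (rule transpose)
  obtain v where v: "\<forall>i<n. 0 < v i" "\<forall>i<n. (\<Sum>j<n. P $$ (i, j) * v j) = r * v i"
    by (rule perron_vector)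
  obtain u where u: "\<forall>i<n. 0 < u i" "\<forall>i<n. (\<Sum>j<n. transpose_mat P $$ (i, j) * u j) = T.r * u i"
    by (rule T.perron_vector)
  have uP: "(\<Sum>i<n. u i * P $$ (i, j)) = T.r * u j" if "j < n" for j
    using u(2) that carrier by (simp add: mult.commute)
  have "T.r * (\<Sum>j<n. u j * v j) = (\<Sum>j<n. (\<Sum>i<n. u i * P $$ (i, j)) * v j)"
    using uP by (simp add: sum_distrib_left mult.assoc)
  also have "\<dots> = (\<Sum>i<n. u i * (\<Sum>j<n. P $$ (i, j) * v j))"
    unfolding sum_distrib_left sum_distrib_right by (subst sum.swap) (simp add: mult.assoc)
  also have "\<dots> = r * (\<Sum>i<n. u i * v i)"
    using v(2) by (simp add: sum_distrib_left mult_ac)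
  finally have eq: "T.r * (\<Sum>j<n. u j * v j) = r * (\<Sum>i<n. u i * v i)" .
  have "0 < (\<Sum>i<n. u i * v i)"
    using u(1) v(1) n_pos by (intro sum_pos) auto
  then have "T.r = r" using eq by simp
  then show ?thesis using that u(1) uP by simp
qed

text \<open>If \<open>r\<close> were a double root, the first two columns of a Schur basis would be a second
  eigenvector or a Jordan chain; a positive left eigenvector rules out the chain.\<close>

lemma count_r:
  assumes es: "eigenvalue_enumeration (complex_mat P) es"
  shows "count (mset es) (complex_of_real r) = 1"
proof -
  let ?r = "complex_of_real r"
  have "?r \<in> set es"
    using eigenvalue_r spectrum_eq_set_enumeration[OF complex_carrier es] by (auto simp: spectrum_def)
  then have "count (mset es) ?r \<ge> 1" by (simp add: Suc_le_eq)
  moreover have "\<not> count (mset es) ?r \<ge> 2"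
  proof
    assume ge: "count (mset es) ?r \<ge> 2"
    then have "{#?r, ?r#} \<subseteq># mset es" by (auto simp: subseteq_mset_def)
    then obtain M where M: "mset es = {#?r, ?r#} + M" by (meson subset_mset.le_iff_add)
    obtain fs where fs: "mset fs = M" using ex_mset by blast
    \<comment> \<open>With both copies of \<open>r\<close> in front, the first two diagonal entries
      of the Schur form are \<open>r\<close>.\<close>
    define es' where "es' = ?r # ?r # fs"
    have es': "eigenvalue_enumeration (complex_mat P) es'"
      by (rule eigenvalue_enumeration_mset[OF es]) (simp add: es'_def M fs)
    obtain B S T where "schur_decomposition (complex_mat P) es' = (B, S, T)"
      by (cases "schur_decomposition (complex_mat P) es'") auto
    then have sim: "similar_mat_wit (complex_mat P) B S T" and ut: "upper_triangular B"
      and diag: "diag_mat B = es'"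
      using schur_decomposition[OF complex_carrier] es' by (auto simp: eigenvalue_enumeration_def)
    note W = similar_mat_witD2[OF complex_carrier sim]
    have "complex_mat P * S = S * B * (T * S)"
      using W complex_carrier by (simp add: assoc_mult_mat[of _ n n _ n _ n])
    then have PS: "complex_mat P * S = S * B" using W by simp
    have col: "(\<Sum>j<n. complex_of_real (P $$ (i, j)) * S $$ (j, c)) = (\<Sum>l<n. S $$ (i, l) * B $$ (l, c))"
      if "i < n" "c < n" for i c
      using arg_cong[OF PS, of "\<lambda>M. M $$ (i, c)"] W(5,6) carrier that
      by (simp add: scalar_prod_def atLeast0LessThan)
    have TS: "(\<Sum>i<n. T $$ (a, i) * S $$ (i, b)) = (if a = b then 1 else 0)" if "a < n" "b < n" for a b
      using arg_cong[OF W(2), of "\<lambda>M. M $$ (a, b)"] W(6,7) that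
      by (simp add: scalar_prod_def atLeast0LessThan)
    have n01: "0 < n" "1 < n" using n by auto
    have Bd: "B $$ (0, 0) = ?r" "B $$ (1, 1) = ?r"
      using arg_cong[OF diag, of "\<lambda>l. l ! 0"] arg_cong[OF diag, of "\<lambda>l. l ! 1"] W(5) n01
      by (auto simp: diag_mat_def es'_def)
    have B0: "B $$ (l, c) = 0" if "l < n" "c < l" for l c
      using upper_triangularD[OF ut that(2)] that W by auto
    \<comment> \<open>Only \<open>b\<close> couples the first two columns of \<open>S\<close>: the
      first is an eigenvector, the second is one up to \<open>b\<close> times the first.\<close>
    define b where "b = B $$ (0, 1)"
    have c0: "(\<Sum>j<n. complex_of_real (P $$ (i, j)) * S $$ (j, 0)) = ?r * S $$ (i, 0)" if "i < n" for i
    proof -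
      have "(\<Sum>l<n. S $$ (i, l) * B $$ (l, 0)) = S $$ (i, 0) * B $$ (0, 0)"
        using n01 B0 by (subst sum.remove[of _ 0]) (auto intro!: sum.neutral)
      then show ?thesis using col[OF that n01(1)] Bd by simp
    qed
    have c1: "(\<Sum>j<n. complex_of_real (P $$ (i, j)) * S $$ (j, 1)) = b * S $$ (i, 0) + ?r * S $$ (i, 1)"
      if "i < n" for i
    proof -
      have "(\<Sum>l<n. S $$ (i, l) * B $$ (l, 1)) = (\<Sum>l\<in>{0, 1}. S $$ (i, l) * B $$ (l, 1))"
        using n01 B0[of _ 1] by (intro sum.mono_neutral_right) auto
      then show ?thesis using col[OF that n01(2)] Bd by (simp add: b_def mult.commute)
    qed
    obtain v where v: "\<forall>i<n. 0 < v i" "\<forall>i<n. (\<Sum>j<n. P $$ (i, j) * v j) = r * v i"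
      by (rule perron_vector)
    obtain u where u: "\<forall>i<n. 0 < u i" "\<forall>j<n. (\<Sum>i<n. u i * P $$ (i, j)) = r * u j"
      by (rule left_perron_vector)
    obtain d where d: "\<And>i. i < n \<Longrightarrow> S $$ (i, 0) = d * complex_of_real (v i)"
      using kernel_one_dim[OF v c0] by blast
    have d0: "d * (\<Sum>i<n. T $$ (0, i) * complex_of_real (v i)) = 1"
      using TS[OF n01(1) n01(1)] d by (simp add: sum_distrib_left mult_ac)
    \<comment> \<open>Pairing the second column with the left eigenvector \<open>u\<close> cancels
      the terms with \<open>r\<close> and leaves \<open>b * d\<close> times a positive
      number.\<close>
    have "(\<Sum>i<n. complex_of_real (u i) * (\<Sum>j<n. complex_of_real (P $$ (i, j)) * S $$ (j, 1))) =
        (\<Sum>j<n. complex_of_real (\<Sum>i<n. u i * P $$ (i, j)) * S $$ (j, 1))"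
      unfolding sum_distrib_left of_real_sum sum_distrib_right by (subst sum.swap) (simp add: mult_ac)
    also have "\<dots> = (\<Sum>j<n. ?r * (complex_of_real (u j) * S $$ (j, 1)))"
      using u(2) by (simp add: mult_ac)
    finally have "(\<Sum>i<n. complex_of_real (u i) * (b * S $$ (i, 0) + ?r * S $$ (i, 1))) =
        (\<Sum>j<n. ?r * (complex_of_real (u j) * S $$ (j, 1)))"
      using c1 by simp
    then have "(\<Sum>i<n. complex_of_real (u i) * (b * S $$ (i, 0))) = 0"
      by (simp add: distrib_left sum.distrib mult_ac)
    then have "b * d * complex_of_real (\<Sum>i<n. u i * v i) = 0"
      using d by (simp add: sum_distrib_left mult_ac)
    moreover have "0 < (\<Sum>i<n. u i * v i)"
      using u(1) v(1) n_pos by (intro sum_pos) auto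
    moreover have "d \<noteq> 0" using d0 by auto
    ultimately have "b = 0" by (simp only: mult_eq_0_iff of_real_eq_0_iff) simp
    then obtain e where e: "\<And>i. i < n \<Longrightarrow> S $$ (i, 1) = e * complex_of_real (v i)"
      using kernel_one_dim[OF v, of "\<lambda>i. S $$ (i, 1)"] c1 by auto
    \<comment> \<open>Both columns are now multiples of \<open>v\<close>, which contradicts the
      invertibility of \<open>S\<close>.\<close>
    have "e * (\<Sum>i<n. T $$ (0, i) * complex_of_real (v i)) = 0"
      using TS[OF n01] e by (simp add: sum_distrib_left mult_ac)
    then have "e = 0" using d0 by auto
    then show False using TS[OF n01(2) n01(2)] e by simp
  qed
  ultimately show ?thesis by linarith
qed

end

subsection \<open>Minors of order two\<close>

text \<open>Index pairs need not be increasing: the expression is antisymmetric in rows and in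
  columns and vanishes on repeated indices, so sums can run over all pairs.\<close>

definition minor2 :: "'a::comm_ring_1 mat \<Rightarrow> nat \<Rightarrow> nat \<Rightarrow> nat \<Rightarrow> nat \<Rightarrow> 'a" where
  "minor2 A i j k l = A $$ (i, k) * A $$ (j, l) - A $$ (i, l) * A $$ (j, k)"

text \<open>Summing over all pairs, rather than over \<open>a < b\<close> as in the Cauchy-Binet formula, counts
  every minor twice.\<close>

lemma minor2_mult:
  fixes A B :: "'a::comm_ring_1 mat"
  assumes A: "A \<in> carrier_mat n n" and B: "B \<in> carrier_mat n n"
    and "i < n" "j < n" "k < n" "l < n"
  shows "2 * minor2 (A * B) i j k l = (\<Sum>a<n. \<Sum>b<n. minor2 A i j a b * minor2 B a b k l)"
proof -
  have entry: "(A * B) $$ (i, k) = (\<Sum>a<n. A $$ (i, a) * B $$ (a, k))" if "i < n" "k < n" for i k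
    using A B that by (simp add: scalar_prod_def atLeast0LessThan)
  let ?t = "\<lambda>i k a. A $$ (i, a) * B $$ (a, k)"
  have "(\<Sum>a<n. \<Sum>b<n. minor2 A i j a b * minor2 B a b k l) =
      (\<Sum>a<n. \<Sum>b<n. ?t i k a * ?t j l b) - (\<Sum>a<n. \<Sum>b<n. ?t i l a * ?t j k b)
      - (\<Sum>a<n. \<Sum>b<n. ?t j k a * ?t i l b) + (\<Sum>a<n. \<Sum>b<n. ?t j l a * ?t i k b)"
    by (simp add: minor2_def algebra_simps sum.distrib sum_subtractf)
  also have "\<dots> = (A * B) $$ (i, k) * (A * B) $$ (j, l) - (A * B) $$ (i, l) * (A * B) $$ (j, k)
      - (A * B) $$ (j, k) * (A * B) $$ (i, l) + (A * B) $$ (j, l) * (A * B) $$ (i, k)"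
    using assms(3-6) by (simp only: entry sum_product)
  also have "\<dots> = 2 * minor2 (A * B) i j k l"
    by (simp add: minor2_def algebra_simps)
  finally show ?thesis ..
qed

lemma pow_mat_add:
  fixes A :: "'a::semiring_1 mat"
  assumes A: "A \<in> carrier_mat n n"
  shows "A ^\<^sub>m (j + k) = A ^\<^sub>m j * A ^\<^sub>m k"
proof (induction k)
  case 0
  then show ?case using A by simp
next
  case (Suc k)
  then show ?case using A by (simp add: assoc_mult_mat[of _ n n _ n _ n])
qed

lemma complex_mat_pow_entry:
  assumes "A \<in> carrier_mat n n" "i < n" "j < n"
  shows "(complex_mat A ^\<^sub>m k) $$ (i, j) = complex_of_real ((A ^\<^sub>m k) $$ (i, j))"
  using assms(2,3) carrier_matD[OF assms(1)]
  unfolding of_real_hom.mat_hom_pow[OF assms(1), symmetric] by simp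

section \<open>Signs of minors and products of eigenvalues\<close>

locale sign_regular =
  fixes n :: nat and s :: "nat \<Rightarrow> nat \<Rightarrow> real" and A :: "real mat"
  assumes carrier: "A \<in> carrier_mat n n"
    and sign: "\<And>i j. i < n \<Longrightarrow> j < n \<Longrightarrow> i \<noteq> j \<Longrightarrow> s i j * s i j = 1"
    and minors: "\<And>i j k l. i < n \<Longrightarrow> j < n \<Longrightarrow> k < n \<Longrightarrow> l < n \<Longrightarrow>
      0 \<le> s i j * s k l * minor2 A i j k l"

text \<open>Inserting \<open>s a b * s a b = 1\<close> splits each term of the Cauchy-Binet sum into
  two factors that are nonnegative by assumption.\<close>

lemma sign_regular_mult:
  assumes "sign_regular n s A" "sign_regular n s B"
  shows "sign_regular n s (A * B)"
proof -
  interpret A: sign_regular n s A by fact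
  interpret B: sign_regular n s B by fact
  have "0 \<le> s i j * s k l * minor2 (A * B) i j k l" if "i < n" "j < n" "k < n" "l < n" for i j k l
  proof -
    have "0 \<le> s i j * s k l * (minor2 A i j a b * minor2 B a b k l)" if "a < n" "b < n" for a b
    proof (cases "a = b")
      case True
      then show ?thesis by (simp add: minor2_def)
    next
      case False
      have "s i j * s k l * (minor2 A i j a b * minor2 B a b k l) =
          s i j * s k l * (s a b * s a b) * (minor2 A i j a b * minor2 B a b k l)"
        using A.sign[OF that False] by simp
      also have "\<dots> = (s i j * s a b * minor2 A i j a b) * (s a b * s k l * minor2 B a b k l)"
        by (simp only: mult_ac)
      also have "0 \<le> \<dots>"
        using A.minors B.minors \<open>i < n\<close> \<open>j < n\<close> \<open>k < n\<close> \<open>l < n\<close> that by (intro mult_nonneg_nonneg[OF A.minors B.minors])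
      finally show ?thesis .
    qed
    then have "0 \<le> s i j * s k l * (\<Sum>a<n. \<Sum>b<n. minor2 A i j a b * minor2 B a b k l)"
      unfolding sum_distrib_left by (intro sum_nonneg) auto
    then show ?thesis
      unfolding minor2_mult[OF A.carrier B.carrier that, symmetric] by simp
  qed
  then show ?thesis
    using A.carrier B.carrier A.sign by unfold_locales auto
qed

lemma sum_off_diagonal_pairs:
  fixes f :: "nat \<Rightarrow> 'a::comm_ring_1"
  shows "(\<Sum>(i, j)\<in>{(i, j). i < n \<and> j < n \<and> i \<noteq> j}. f i * f j) = (\<Sum>i<n. f i)\<^sup>2 - (\<Sum>i<n. f i * f i)"
proof -
  have "(\<Sum>i<n. f i)\<^sup>2 = (\<Sum>(i, j)\<in>{..<n} \<times> {..<n}. f i * f j)"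
    by (simp add: power2_eq_square sum_product sum.cartesian_product)
  also have "{..<n} \<times> {..<n} = {(i, j). i < n \<and> j < n \<and> i \<noteq> j} \<union> (\<lambda>i. (i, i)) ` {..<n}"
    by auto
  also have "(\<Sum>(i, j)\<in>\<dots>. f i * f j) =
      (\<Sum>(i, j)\<in>{(i, j). i < n \<and> j < n \<and> i \<noteq> j}. f i * f j) + (\<Sum>(i, j)\<in>(\<lambda>i. (i, i)) ` {..<n}. f i * f j)"
    by (intro sum.union_disjoint finite_subset[of "{(i, j). i < n \<and> j < n \<and> i \<noteq> j}" "{..<n} \<times> {..<n}"]) auto
  also have "(\<Sum>(i, j)\<in>(\<lambda>i. (i, i)) ` {..<n}. f i * f j) = (\<Sum>i<n. f i * f i)"
    by (subst sum.reindex) (auto simp: inj_on_def)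
  finally show ?thesis by simp
qed

lemma finite_off_diagonal_pairs: "finite {(i, j). i < n \<and> j < n \<and> i \<noteq> (j::nat)}"
  by (rule finite_subset[of _ "{..<n} \<times> {..<n}"]) auto

context sign_regular
begin

text \<open>Exponents start at one: the identity matrix meets the sign condition only for
  antisymmetric \<open>s\<close>, which the locale does not demand.\<close>

lemma power: "sign_regular n s (A ^\<^sub>m Suc k)"
proof (induction k)
  case 0
  have "A ^\<^sub>m Suc 0 = A" using carrier by simp
  then show ?case using sign_regular_axioms by simp
next
  case (Suc k)
  then show ?case
    using sign_regular_mult[OF Suc sign_regular_axioms] by simp
qed

text \<open>Principal minors carry the sign factor \<open>s i j * s i j = 1\<close>; their sum over
  all \<open>i\<close> and \<open>j\<close> is the difference of the two sides.\<close>

lemma sum_diag_square_le: "(\<Sum>i<n. (A * A) $$ (i, i)) \<le> (\<Sum>i<n. A $$ (i, i))\<^sup>2"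
proof -
  have "0 \<le> minor2 A i j i j" if "i < n" "j < n" for i j
  proof (cases "i = j")
    case False
    then show ?thesis using minors[OF that that] sign[OF that] by simp
  qed (simp add: minor2_def)
  then have "0 \<le> (\<Sum>i<n. \<Sum>j<n. minor2 A i j i j)"
    by (intro sum_nonneg) auto
  also have "\<dots> = (\<Sum>i<n. A $$ (i, i))\<^sup>2 - (\<Sum>i<n. (A * A) $$ (i, i))"
    using carrier
    by (simp add: minor2_def sum_subtractf power2_eq_square sum_product scalar_prod_def atLeast0LessThan)
  finally show ?thesis by simp
qed

text \<open>The products \<open>\<lambda>\<^sub>i \<lambda>\<^sub>j\<close>, \<open>i \<noteq> j\<close>, are the eigenvalues of the second compound matrix, each taken
  twice; their power sums are obtained from traces of powers of \<open>A\<close> alone.\<close>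

lemma pair_power_sums_nonneg:
  assumes es: "eigenvalue_enumeration (complex_mat A) es"
  shows "\<exists>x\<ge>0. (\<Sum>(i, j)\<in>{(i, j). i < n \<and> j < n \<and> i \<noteq> j}. (es ! i * es ! j) ^ Suc k) = complex_of_real x"
proof -
  have C: "complex_mat A \<in> carrier_mat n n" using carrier by simp
  let ?B = "A ^\<^sub>m Suc k"
  interpret B: sign_regular n s ?B by (rule power)
  have tr: "(\<Sum>i<n. es ! i ^ m) = complex_of_real (\<Sum>i<n. (A ^\<^sub>m m) $$ (i, i))" for m
  proof -
    show ?thesis
      unfolding sum_diag_pow[OF C es, symmetric] by (simp add: complex_mat_pow_entry[OF carrier])
  qed
  have "(\<Sum>(i, j)\<in>{(i, j). i < n \<and> j < n \<and> i \<noteq> j}. (es ! i * es ! j) ^ Suc k) =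
      (\<Sum>i<n. es ! i ^ Suc k)\<^sup>2 - (\<Sum>i<n. es ! i ^ (Suc k + Suc k))"
    unfolding power_mult_distrib sum_off_diagonal_pairs power_add ..
  also have "\<dots> = complex_of_real ((\<Sum>i<n. ?B $$ (i, i))\<^sup>2 - (\<Sum>i<n. (?B * ?B) $$ (i, i)))"
    unfolding tr pow_mat_add[OF carrier] by (simp del: pow_mat.simps)
  finally show ?thesis
    using B.sum_diag_square_le by (intro exI conjI) (simp_all only: diff_ge_0_iff_ge)
qed

text \<open>Dividing by \<open>R\<close> brings the products into the closed unit disc, where
  nonnegative power sums make \<open>1\<close> at least as frequent as any other unimodular
  value.\<close>

lemma card_pair_products_le:
  assumes es: "eigenvalue_enumeration (complex_mat A) es" and "0 < R" "cmod z = R"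
    and bound: "\<And>i j. i < n \<Longrightarrow> j < n \<Longrightarrow> i \<noteq> j \<Longrightarrow> cmod (es ! i * es ! j) \<le> R"
  shows "card {(i, j). i < n \<and> j < n \<and> i \<noteq> j \<and> es ! i * es ! j = z} \<le>
    card {(i, j). i < n \<and> j < n \<and> i \<noteq> j \<and> es ! i * es ! j = complex_of_real R}"
proof -
  let ?I = "{(i, j). i < n \<and> j < n \<and> i \<noteq> j}"
  define \<mu> where "\<mu> p = es ! fst p * es ! snd p / complex_of_real R" for p
  have set: "{(i, j). i < n \<and> j < n \<and> i \<noteq> j \<and> es ! i * es ! j = w} = {p \<in> ?I. \<mu> p = w / complex_of_real R}"
    for w using \<open>0 < R\<close> by (auto simp: \<mu>_def)
  have "card {p \<in> ?I. \<mu> p = z / complex_of_real R} \<le> card {p \<in> ?I. \<mu> p = 1}"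
  proof (rule nonneg_power_sums_card_le[OF finite_off_diagonal_pairs])
    show "cmod (\<mu> p) \<le> 1" if "p \<in> ?I" for p
      using bound[of "fst p" "snd p"] that \<open>0 < R\<close> by (auto simp: \<mu>_def norm_divide norm_mult)
    show "cmod (z / complex_of_real R) = 1"
      using assms(2,3) by (simp add: norm_divide)
    fix k
    obtain x where "0 \<le> x" and x: "(\<Sum>(i, j)\<in>?I. (es ! i * es ! j) ^ Suc k) = complex_of_real x"
      using pair_power_sums_nonneg[OF es] by blast
    have "\<mu> p ^ Suc k = (case p of (i, j) \<Rightarrow> (es ! i * es ! j) ^ Suc k) / complex_of_real R ^ Suc k" for p
      by (cases p) (simp only: \<mu>_def fst_conv snd_conv prod.case power_divide)
    then have "(\<Sum>p\<in>?I. \<mu> p ^ Suc k) =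
        (\<Sum>(i, j)\<in>?I. (es ! i * es ! j) ^ Suc k) / complex_of_real R ^ Suc k"
      by (simp only: sum_divide_distrib)
    also have "\<dots> = complex_of_real (x / R ^ Suc k)"
      unfolding x by simp
    finally show "\<exists>x\<ge>0. (\<Sum>p\<in>?I. \<mu> p ^ Suc k) = complex_of_real x"
      using \<open>0 \<le> x\<close> \<open>0 < R\<close> by (intro exI[of _ "x / R ^ Suc k"]) simp
  qed
  then show ?thesis
    using \<open>0 < R\<close> by (simp only: set) (simp add: divide_self)
qed

end

lemma count_mset_eq_card: "count (mset xs) z = card {i \<in> {..<length xs}. xs ! i = z}"
  unfolding count_mset count_list_eq_length_filter length_filter_conv_card
  by (rule arg_cong[of _ _ card]) auto

context nonneg_irreducible
begin

lemma cmod_le_r: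
  assumes "eigenvalue_enumeration (complex_mat P) es" "z \<in> set es"
  shows "cmod z \<le> r"
  using spectral_radius_mem_max(2)[OF complex_carrier n_pos]
    spectrum_eq_set_enumeration[OF complex_carrier assms(1)] assms(2) by auto

text \<open>Traces of powers of \<open>P\<close> are nonnegative, so no peripheral value is more
  frequent than \<open>r\<close>, which occurs once.\<close>

lemma count_peripheral:
  assumes es: "eigenvalue_enumeration (complex_mat P) es" and z: "z \<in> peripheral_spectrum (complex_mat P)"
  shows "count (mset es) z = 1"
proof -
  have len: "length es = n" using es carrier by (simp add: eigenvalue_enumeration_def)
  define \<mu> where "\<mu> i = es ! i / complex_of_real r" for i
  have card: "card {i \<in> {..<n}. \<mu> i = w / complex_of_real r} = count (mset es) w" for w
    unfolding count_mset_eq_card len using r_pos by (simp add: \<mu>_def)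
  have "card {i \<in> {..<n}. \<mu> i = z / complex_of_real r} \<le> card {i \<in> {..<n}. \<mu> i = 1}"
  proof (rule nonneg_power_sums_card_le)
    show "cmod (\<mu> i) \<le> 1" if "i \<in> {..<n}" for i
      using cmod_le_r[OF es, of "es ! i"] len that r_pos by (simp add: \<mu>_def norm_divide)
    show "cmod (z / complex_of_real r) = 1"
      using z r_pos by (simp add: peripheral_spectrum_eq norm_divide)
    fix k
    let ?t = "\<Sum>i<n. (P ^\<^sub>m Suc k) $$ (i, i)"
    have "(\<Sum>i<n. es ! i ^ Suc k) = complex_of_real ?t"
      unfolding sum_diag_pow[OF complex_carrier es, symmetric]
      by (simp add: complex_mat_pow_entry[OF carrier] del: pow_mat.simps)
    then have "(\<Sum>i<n. \<mu> i ^ Suc k) = complex_of_real (?t / r ^ Suc k)"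
      unfolding \<mu>_def power_divide sum_divide_distrib[symmetric] by (simp del: pow_mat.simps power_Suc)
    moreover have "0 \<le> ?t"
      using nonneg_pow_lower_bound[OF carrier nonneg, of 0 "\<lambda>_. 0" "Suc k"] by (intro sum_nonneg) auto
    ultimately show "\<exists>x\<ge>0. (\<Sum>i<n. \<mu> i ^ Suc k) = complex_of_real x"
      using r_pos by (intro exI[of _ "?t / r ^ Suc k"]) (simp del: pow_mat.simps power_Suc)
  qed simp
  then have "count (mset es) z \<le> 1"
    using card[of z] card[of "complex_of_real r"] count_r[OF es] r_pos by simp
  moreover have "z \<in> set es"
    using z spectrum_eq_set_enumeration[OF complex_carrier es] by (auto simp: peripheral_spectrum_def)
  ultimately show ?thesis by (simp add: le_antisym Suc_le_eq)
qed

end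

text \<open>Numbering \<open>K\<close> first moves the vanishing entries into the upper right block.
  This links the block form to the edge condition of \<open>nonneg_irreducible\<close>.\<close>

lemma reducible_mat_if_invariant:
  assumes A: "A \<in> carrier_mat n n" and K: "K \<subseteq> {..<n}" "K \<noteq> {}" "K \<noteq> {..<n}"
    and zero: "\<And>i j. i \<in> K \<Longrightarrow> j \<in> {..<n} - K \<Longrightarrow> A $$ (i, j) = 0"
  shows "reducible_mat A"
proof -
  define r where "r = card K"
  have finK: "finite K" using K finite_subset by blast
  have r: "1 \<le> r" "r < n"
    using K finK psubset_card_mono[of "{..<n}" K] by (auto simp: r_def Suc_le_eq card_gt_0_iff)
  obtain f where f: "bij_betw f {..<r} K"
    using finite_same_card_bij[of "{..<r}" K] finK by (auto simp: r_def)
  obtain g where g: "bij_betw g ({..<n} - {..<r}) ({..<n} - K)"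
    using finite_same_card_bij[of "{..<n} - {..<r}" "{..<n} - K"] finK K r
    by (auto simp: card_Diff_subset r_def)
  \<comment> \<open>The last case is there because \<open>permutes\<close> demands the identity
    outside \<open>{..<n}\<close>.\<close>
  define p where "p i = (if i < r then f i else if i < n then g i else i)" for i
  have pf: "bij_betw p {..<r} K"
    using f by (subst bij_betw_cong[of _ _ f]) (auto simp: p_def)
  have pg: "bij_betw p ({..<n} - {..<r}) ({..<n} - K)"
    using g by (subst bij_betw_cong[of _ _ g]) (auto simp: p_def)
  from pf pg have "bij_betw p ({..<r} \<union> ({..<n} - {..<r})) (K \<union> ({..<n} - K))"
    by (rule bij_betw_combine) auto
  moreover have "{..<r} \<union> ({..<n} - {..<r}) = {..<n}" "K \<union> ({..<n} - K) = {..<n}"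
    using r K by auto
  ultimately have p: "p permutes {..<n}"
    by (intro bij_imp_permutes) (auto simp: p_def r)
  have pK: "p i \<in> K" if "i < r" for i
    using pf that by (auto simp: bij_betw_def)
  have pnK: "p i \<in> {..<n} - K" if "i < n" "\<not> i < r" for i
    using pg that by (auto simp: bij_betw_def)
  have block: "A $$ (p i, p j) = 0" if "i < r" "j < n" "\<not> j < r" for i j
    using zero pK[OF that(1)] pnK[OF that(2,3)] by blast
  let ?M = "\<lambda>i j. A $$ (p i, p j)"
  have "mat n n (\<lambda>(i, j). ?M i j) = four_block_mat (mat r r (\<lambda>(i, j). ?M i j)) (0\<^sub>m r (n - r))
      (mat (n - r) r (\<lambda>(i, j). ?M (i + r) j)) (mat (n - r) (n - r) (\<lambda>(i, j). ?M (i + r) (j + r)))"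
    using r block by (intro eq_matI) auto
  then show ?thesis
    using A p r unfolding reducible_mat_def
    by (intro exI[of _ p] exI[of _ r] exI[of _ "n - r"] exI[of _ "mat r r (\<lambda>(i, j). ?M i j)"]
        exI[of _ "mat (n - r) r (\<lambda>(i, j). ?M (i + r) j)"]
        exI[of _ "mat (n - r) (n - r) (\<lambda>(i, j). ?M (i + r) (j + r))"]) simp
qed

section \<open>Oddness of the period and the second eigenvalue\<close>

locale sign_regular_irreducible = nonneg_irreducible n P + sign_regular n s P for n s P
begin

text \<open>If the number \<open>h\<close> of peripheral eigenvalues were even, then \<open>- r\<close> would be peripheral. A product
  \<open>r z\<close> of peripheral eigenvalues with \<open>z\<close> not a square would be attained by \<open>h\<close> ordered pairs of
  distinct eigenvalues, but \<open>r\<^sup>2\<close> by at most \<open>h - 2\<close>, since \<open>r\<close> and \<open>- r\<close> would have to be paired with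
  themselves.\<close>

lemma odd_card_peripheral: "odd (card (peripheral_spectrum (complex_mat P)))"
proof
  let ?G = "peripheral_spectrum (complex_mat P)" and ?r = "complex_of_real r"
  define h where "h = card ?G"
  assume "even (card ?G)"
  then have "even h" by (simp add: h_def)
  have G: "?G = {z. z ^ h = ?r ^ h}"
    using peripheral_spectrum_roots unfolding h_def[symmetric] of_real_power .
  have G0: "z \<noteq> 0" "cmod z = r" if "z \<in> ?G" for z using that r_pos by (auto simp: peripheral_spectrum_eq)
  have r: "?r \<noteq> 0" using r_pos by simp
  have rG: "?r \<in> ?G" "- ?r \<in> ?G" using \<open>even h\<close> by (simp_all add: G)
  have ne: "?r \<noteq> - ?r" using r by simp
  obtain es where es: "eigenvalue_enumeration (complex_mat P) es"
    using eigenvalue_enumeration_exists[OF complex_carrier] by blast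
  have len: "length es = n" using es carrier by (simp add: eigenvalue_enumeration_def)
  have set_es: "set es = spectrum (complex_mat P)"
    using spectrum_eq_set_enumeration[OF complex_carrier es] by simp
  have le: "cmod (es ! i) \<le> r" if "i < n" for i
    using cmod_le_r[OF es] that len by simp
  have inG: "es ! i \<in> ?G" if "i < n" "cmod (es ! i) = r" for i
    using that nth_mem[of i es] len set_es by (simp add: peripheral_spectrum_def)
  have inj: "i = j" if "i < n" "j < n" "es ! i = es ! j" "cmod (es ! i) = r" for i j
  proof -
    have "card {k \<in> {..<n}. es ! k = es ! i} = 1"
      using count_peripheral[OF es inG[OF that(1,4)]] unfolding count_mset_eq_card len .
    then obtain k where k: "{k \<in> {..<n}. es ! k = es ! i} = {k}" by (rule card_1_singletonE)
    have "i \<in> {k \<in> {..<n}. es ! k = es ! i}" "j \<in> {k \<in> {..<n}. es ! k = es ! i}"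
      using that by simp_all
    then show ?thesis unfolding k by simp
  qed
  \<comment> \<open>Peripheral eigenvalues are simple, so their values and positions in
    \<open>es\<close> correspond; \<open>ix\<close> returns the position of a value.\<close>
  define ix where "ix z = (SOME i. i < n \<and> es ! i = z)" for z
  have ix: "ix z < n" "es ! ix z = z" if "z \<in> ?G" for z
  proof -
    have "z \<in> set es" using that set_es by (simp add: peripheral_spectrum_def)
    then have "\<exists>i. i < n \<and> es ! i = z" unfolding in_set_conv_nth len .
    from someI_ex[OF this] show "ix z < n" "es ! ix z = z" by (simp_all add: ix_def)
  qed
  \<comment> \<open>This is squaring in the group with neutral element \<open>r\<close>. It
    identifies \<open>r\<close> with \<open>- r\<close>, so on a finite set it must miss some
    \<open>z\<close>.\<close>
  define q where "q x = x * x / ?r" for x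
  have "q ` ?G \<noteq> ?G"
  proof
    assume "q ` ?G = ?G"
    then have "inj_on q ?G" by (intro eq_card_imp_inj_on finite_peripheral) simp
    moreover have "q ?r = q (- ?r)" by (simp add: q_def)
    ultimately show False using rG ne by (meson inj_onD)
  qed
  moreover have "q ` ?G \<subseteq> ?G" using peripheral_mult by (auto simp: q_def)
  ultimately obtain z where "z \<in> ?G" and nz: "z \<notin> q ` ?G" by blast
  have nonsquare: "x * x \<noteq> ?r * z" if "x \<in> ?G" for x
  proof
    assume "x * x = ?r * z"
    then have "q x = z" using r by (simp add: q_def)
    then show False using nz that by blast
  qed
  note z = \<open>z \<in> ?G\<close> nonsquare
  let ?pairs = "\<lambda>w. {(i, j). i < n \<and> j < n \<and> i \<noteq> j \<and> es ! i * es ! j = w}"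
  have fin: "finite (?pairs w)" for w
    by (rule finite_subset[OF _ finite_off_diagonal_pairs[of n]]) auto
  have "h \<le> card (?pairs (?r * z))"
    unfolding h_def
  proof (rule card_inj_on_le[of "\<lambda>x. (ix x, ix (?r * z / x))", OF _ _ fin])
    show "inj_on (\<lambda>x. (ix x, ix (?r * z / x))) ?G"
      using ix(2) by (intro inj_onI) (metis prod.inject)
    show "(\<lambda>x. (ix x, ix (?r * z / x))) ` ?G \<subseteq> ?pairs (?r * z)"
    proof
      fix p assume "p \<in> (\<lambda>x. (ix x, ix (?r * z / x))) ` ?G"
      then obtain x where x: "x \<in> ?G" "p = (ix x, ix (?r * z / x))" by blast
      have y: "?r * z / x \<in> ?G"
        using x(1) z(1) r by (simp add: G power_mult_distrib power_divide)
      have "ix x \<noteq> ix (?r * z / x)"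
      proof
        assume "ix x = ix (?r * z / x)"
        then have "es ! ix x = es ! ix (?r * z / x)" by (rule arg_cong)
        then have "?r * z / x = x" unfolding ix(2)[OF x(1)] ix(2)[OF y] by (rule sym)
        then have "?r * z = x * x" unfolding nonzero_divide_eq_eq[OF G0(1)[OF x(1)]] .
        then show False using z(2)[OF x(1)] by simp
      qed
      then show "p \<in> ?pairs (?r * z)"
        using ix[OF x(1)] ix[OF y] G0(1)[OF x(1)] x(2) by simp
    qed
  qed
  also have "\<dots> \<le> card (?pairs (complex_of_real (r * r)))"
  proof (rule card_pair_products_le[OF es])
    show "0 < r * r" "cmod (?r * z) = r * r"
      using r_pos G0[OF z(1)] by (simp_all add: norm_mult)
    show "cmod (es ! i * es ! j) \<le> r * r" if "i < n" "j < n" for i j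
      using le[OF that(1)] le[OF that(2)] r_pos by (simp add: norm_mult mult_mono)
  qed
  also have "\<dots> \<le> card (?G - {?r, - ?r})"
  proof (rule card_inj_on_le[of "\<lambda>(i, j). es ! i"])
    \<comment> \<open>Two factors of modulus at most \<open>r\<close> with a product of modulus
      \<open>r * r\<close> both lie on the circle.\<close>
    have per: "cmod (es ! i) = r" "cmod (es ! j) = r" if "(i, j) \<in> ?pairs (complex_of_real (r * r))" for i j
    proof -
      have ij: "i < n" "j < n" and "cmod (es ! i * es ! j) = r * r"
        using that r_pos by (auto simp: norm_mult)
      then have eq: "cmod (es ! i) * cmod (es ! j) = r * r" by (simp add: norm_mult)
      have "cmod (es ! i) * cmod (es ! j) \<le> cmod (es ! i) * r" "cmod (es ! i) * cmod (es ! j) \<le> r * cmod (es ! j)"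
        using le ij by (auto intro: mult_left_mono mult_right_mono)
      then have "r \<le> cmod (es ! i)" "r \<le> cmod (es ! j)"
        unfolding eq using r_pos by simp_all
      then show "cmod (es ! i) = r" "cmod (es ! j) = r" using le ij by (auto intro: antisym)
    qed
    show "inj_on (\<lambda>(i, j). es ! i) (?pairs (complex_of_real (r * r)))"
    proof (rule inj_onI, clarify)
      fix i j i' j'
      assume p: "i < n" "j < n" "i \<noteq> j" "es ! i * es ! j = complex_of_real (r * r)"
        and p': "i' < n" "j' < n" "i' \<noteq> j'" "es ! i' * es ! j' = complex_of_real (r * r)"
        and eq: "es ! i = es ! i'"
      have c: "cmod (es ! i) = r" "cmod (es ! j) = r" using per[of i j] p by auto
      then have "es ! i \<noteq> 0" using r_pos by auto
      then have "es ! j = es ! j'" using p(4) p'(4) eq by (metis mult_cancel_left)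
      then show "i = i' \<and> j = j'" using inj[OF p(1) p'(1) eq c(1)] inj[OF p(2) p'(2) _ c(2)] by simp
    qed
    show "(\<lambda>(i, j). es ! i) ` ?pairs (complex_of_real (r * r)) \<subseteq> ?G - {?r, - ?r}"
    proof clarify
      fix i j assume p: "i < n" "j < n" "i \<noteq> j" "es ! i * es ! j = complex_of_real (r * r)"
      have c: "cmod (es ! i) = r" using per[of i j] p by auto
      then have i0: "es ! i \<noteq> 0" using r_pos by auto
      have "es ! i = es ! j" if "es ! i = ?r \<or> es ! i = - ?r"
      proof -
        have "es ! i * es ! i = complex_of_real (r * r)" using that by auto
        then have "es ! i * es ! i = es ! i * es ! j" using p(4) by (rule trans[OF _ sym])
        then show ?thesis using i0 by (rule mult_left_cancel[THEN iffD1, rotated])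
      qed
      then have "\<not> (es ! i = ?r \<or> es ! i = - ?r)" using inj[OF p(1,2) _ c] p(3) by blast
      then show "es ! i \<in> ?G - {?r, - ?r}" using inG[OF p(1) c] by blast
    qed
    show "finite (?G - {?r, - ?r})" using finite_peripheral by simp
  qed
  also have "\<dots> < h"
    unfolding h_def using rG finite_peripheral by (intro psubset_card_mono) auto
  finally show False by simp
qed

text \<open>By \<open>anti\<close> and \<open>sign\<close> the relation is a tournament;
  transitivity makes it a strict linear order, whose least element is \<open>m\<close>.\<close>

lemma diag_pos_if_transitive:
  assumes anti: "\<And>i j. i < n \<Longrightarrow> j < n \<Longrightarrow> i \<noteq> j \<Longrightarrow> s j i = - s i j"
    and trans: "transitive_W n {(i, j). s i j = 1}"
  obtains m where "m < n" "P $$ (m, m) \<noteq> 0"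
proof -
  have pm: "s i j = 1 \<or> s i j = - 1" if "i < n" "j < n" "i \<noteq> j" for i j
    using sign[OF that] by (metis square_eq_1_iff)
  define R where "R i j \<longleftrightarrow> i \<noteq> j \<and> s i j = 1" for i j
  have "transp_on {..<n} R"
  proof (rule transp_onI)
    fix i j k assume ijk: "i \<in> {..<n}" "j \<in> {..<n}" "k \<in> {..<n}" "R i j" "R j k"
    \<comment> \<open>\<open>transitive_W\<close> speaks of distinct indices only; antisymmetry
      excludes a two-cycle.\<close>
    have "i \<noteq> k"
    proof
      assume "i = k"
      then show False using ijk anti[of i j] by (simp add: R_def)
    qed
    then show "R i k" using ijk trans unfolding transitive_W_def R_def by auto
  qed
  moreover have "totalp_on {..<n} R"
  proof (rule totalp_onI)
    fix i j assume "i \<in> {..<n}" "j \<in> {..<n}" "i \<noteq> j"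
    then show "R i j \<or> R j i" using pm[of i j] anti[of i j] by (auto simp: R_def)
  qed
  ultimately obtain m where "m \<in> {..<n}" "\<forall>x\<in>{..<n}. x \<noteq> m \<longrightarrow> R m x"
    using Finite_Set.bex_least_element[of "{..<n}" R] n_pos by auto
  then have m: "m < n" "\<And>x. x < n \<Longrightarrow> x \<noteq> m \<Longrightarrow> s m x = 1" by (auto simp: R_def)
  show ?thesis
  proof (rule that[OF m(1)])
    have "{m} \<noteq> {..<n}"
    proof
      assume "{m} = {..<n}"
      then have "card {..<n} = 1" by (metis card_1_singleton_iff One_nat_def)
      then show False using n by simp
    qed
    then obtain l j where l: "l < n" "l \<noteq> m" "P $$ (m, l) \<noteq> 0" and j: "j < n" "j \<noteq> m" "P $$ (j, m) \<noteq> 0"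
      using edge[of "{m}"] edge_into[of "{m}"] m(1) by auto
    have "0 < P $$ (m, l) * P $$ (j, m)"
      using l j nonneg[OF m(1) l(1)] nonneg[OF j(1) m(1)] by simp
    \<comment> \<open>Both index pairs start with \<open>m\<close>, so their signs are
      \<open>1\<close>, and \<open>P m m * P j l\<close> is at least the positive product
      \<open>P m l * P j m\<close>.\<close>
    moreover have "0 \<le> minor2 P m j m l"
      using minors[OF m(1) j(1) m(1) l(1)] m(2) l j by simp
    ultimately show "P $$ (m, m) \<noteq> 0" by (auto simp: minor2_def)
  qed
qed

text \<open>The maximal modulus of a product of two eigenvalues is attained as a value. If it is
  nonzero, only pairs containing \<open>r\<close> reach it, so the second largest modulus is itself
  an eigenvalue.\<close>

lemma second_eigenvalue:
  assumes h: "peripheral_spectrum (complex_mat P) = {complex_of_real r}"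
  shows "\<exists>es l2. eigenvalue_enumeration (complex_mat P) es \<and>
    sorted_wrt (\<lambda>x y. cmod x \<ge> cmod y) es \<and> es ! 0 = complex_of_real r \<and>
    es ! 1 = complex_of_real l2 \<and> 0 \<le> l2 \<and> l2 < r"
proof -
  obtain es0 where es0: "eigenvalue_enumeration (complex_mat P) es0"
    using eigenvalue_enumeration_exists[OF complex_carrier] by blast
  define es where "es = rev (sort_key cmod es0)"
  have es: "eigenvalue_enumeration (complex_mat P) es"
    by (rule eigenvalue_enumeration_mset[OF es0]) (simp add: es_def)
  have "sorted_wrt (\<lambda>x y. cmod x \<le> cmod y) (sort_key cmod es0)"
    using sorted_sort_key[of cmod es0] by (simp add: sorted_wrt_map)
  then have sorted: "sorted_wrt (\<lambda>x y. cmod x \<ge> cmod y) es"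
    by (simp add: es_def sorted_wrt_rev)
  have len: "length es = n" using es carrier by (simp add: eigenvalue_enumeration_def)
  have le: "cmod (es ! j) \<le> cmod (es ! i)" if "i \<le> j" "j < n" for i j
    using sorted that len by (cases "i = j") (auto simp: sorted_wrt_iff_nth_less)
  have set_es: "set es = spectrum (complex_mat P)"
    using spectrum_eq_set_enumeration[OF complex_carrier es] by simp
  have le_r: "cmod (es ! i) \<le> r" if "i < n" for i
    using cmod_le_r[OF es] that len by simp
  have per: "es ! i = complex_of_real r" if "i < n" "cmod (es ! i) = r" for i
  proof -
    have "es ! i \<in> peripheral_spectrum (complex_mat P)"
      using that nth_mem[of i es] len set_es by (simp add: peripheral_spectrum_def)
    then show ?thesis using h by simp
  qed
  have n1: "1 < n" using n by simp
  have "complex_of_real r \<in> set es" using eigenvalue_r set_es by (simp add: spectrum_def)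
  then obtain i0 where "i0 < n" "es ! i0 = complex_of_real r" unfolding in_set_conv_nth len by blast
  then have "r \<le> cmod (es ! 0)" using le[of 0 i0] r_pos by simp
  then have es_0: "es ! 0 = complex_of_real r"
    using per[of 0] le_r[of 0] n_pos by simp
  have lt: "cmod (es ! i) < r" if "1 \<le> i" "i < n" for i
  proof (rule ccontr)
    assume "\<not> cmod (es ! i) < r"
    then have "es ! i = complex_of_real r" using per le_r that by force
    then have "{0, i} \<subseteq> {k \<in> {..<n}. es ! k = complex_of_real r}" using that es_0 by auto
    then have "card {0, i} \<le> card {k \<in> {..<n}. es ! k = complex_of_real r}" by (intro card_mono) auto
    then show False
      using count_r[OF es] that unfolding count_mset_eq_card len by simp
  qed
  have "\<exists>j. 1 \<le> j \<and> j < n \<and> es ! j = complex_of_real (cmod (es ! 1))"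
  \<comment> \<open>If \<open>es ! 1 = 0\<close>, the maximal modulus \<open>R\<close> would be zero
    and could not serve for scaling, but position \<open>1\<close> already works.\<close>
  proof (cases "es ! 1 = 0")
    case True
    then show ?thesis using n1 by auto
  next
    case False
    define R where "R = r * cmod (es ! 1)"
    have R: "0 < R" using r_pos False by (simp add: R_def)
    let ?pairs = "\<lambda>w. {(i, j). i < n \<and> j < n \<and> i \<noteq> j \<and> es ! i * es ! j = w}"
    have fin: "finite (?pairs w)" for w
      by (rule finite_subset[OF _ finite_off_diagonal_pairs[of n]]) auto
    have "cmod (es ! i * es ! j) \<le> R" if ij: "i < n" "j < n" "i \<noteq> j" for i j
    proof -
      consider "1 \<le> i" | "1 \<le> j" using ij(3) by linarith
      then show ?thesis
      proof cases
        case 1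
        then have "cmod (es ! j) * cmod (es ! i) \<le> r * cmod (es ! 1)"
          using le_r[OF ij(2)] le[OF 1 ij(1)] r_pos by (intro mult_mono) auto
        then show ?thesis by (simp add: norm_mult R_def mult.commute)
      next
        case 2
        then have "cmod (es ! i) * cmod (es ! j) \<le> r * cmod (es ! 1)"
          using le_r[OF ij(1)] le[OF 2 ij(2)] r_pos by (intro mult_mono) auto
        then show ?thesis by (simp add: norm_mult R_def)
      qed
    qed
    then have "card (?pairs (es ! 0 * es ! 1)) \<le> card (?pairs (complex_of_real R))"
      using R r_pos by (intro card_pair_products_le[OF es]) (auto simp: R_def norm_mult es_0)
    moreover have "(0, 1) \<in> ?pairs (es ! 0 * es ! 1)" using n1 by simp
    then have "0 < card (?pairs (es ! 0 * es ! 1))" using fin by (auto simp: card_gt_0_iff)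
    ultimately have "0 < card (?pairs (complex_of_real R))" by linarith
    then have "?pairs (complex_of_real R) \<noteq> {}" unfolding card_gt_0_iff by (rule conjunct1)
    then obtain i j where ij: "i < n" "j < n" "i \<noteq> j" "es ! i * es ! j = complex_of_real R" by auto
    \<comment> \<open>Two factors away from position \<open>0\<close> have moduli below
      \<open>r\<close> and at most \<open>cmod (es ! 1)\<close>, too small for the product
      \<open>R\<close>.\<close>
    have "i = 0 \<or> j = 0"
    proof (rule ccontr)
      assume "\<not> (i = 0 \<or> j = 0)"
      then have "1 \<le> i" "1 \<le> j" by auto
      then have "cmod (es ! i) * cmod (es ! j) \<le> cmod (es ! i) * cmod (es ! 1)"
        using le[of 1 j] ij by (intro mult_left_mono) auto
      also have "\<dots> < r * cmod (es ! 1)"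
        using lt[OF \<open>1 \<le> i\<close> ij(1)] False by simp
      also have "\<dots> = cmod (complex_of_real R)" using R by (simp only: norm_of_real R_def)
      also have "\<dots> = cmod (es ! i) * cmod (es ! j)" by (simp only: ij(4)[symmetric] norm_mult)
      finally show False by simp
    qed
    then show ?thesis
    proof
      assume "i = 0"
      then have "es ! j = complex_of_real (cmod (es ! 1))"
        using ij(4) r_pos es_0 by (simp add: R_def)
      then show ?thesis using ij \<open>i = 0\<close> by (intro exI[of _ j]) auto
    next
      assume "j = 0"
      then have "es ! i = complex_of_real (cmod (es ! 1))"
        using ij(4) r_pos es_0 by (simp add: R_def mult.commute)
      then show ?thesis using ij \<open>j = 0\<close> by (intro exI[of _ i]) auto
    qed
  qed
  then obtain j where j: "1 \<le> j" "j < n" "es ! j = complex_of_real (cmod (es ! 1))" by blast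
  \<comment> \<open>The swapped entries have equal modulus, so the list remains sorted.\<close>
  define es' where "es' = es[j := es ! 1, 1 := es ! j]"
  have "mset es' = mset es"
    unfolding es'_def by (rule mset_swap) (use n1 j len in auto)
  then have "eigenvalue_enumeration (complex_mat P) es'"
    by (rule eigenvalue_enumeration_mset[OF es])
  moreover have "cmod (es' ! i) = cmod (es ! i)" if "i < n" for i
    using j len n1 arg_cong[OF j(3), of cmod] that by (auto simp: es'_def nth_list_update)
  then have "sorted_wrt (\<lambda>x y. cmod x \<ge> cmod y) es'"
    using sorted len by (simp add: sorted_wrt_iff_nth_less es'_def)
  moreover have "es' ! 0 = complex_of_real r" using j es_0 by (simp add: es'_def)
  moreover have "es' ! 1 = complex_of_real (cmod (es ! 1))" using j n1 len by (simp add: es'_def)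
  ultimately show ?thesis
    using lt[of 1] n1 by (intro exI[of _ es'] exI[of _ "cmod (es ! 1)"]) auto
qed

end

subsection \<open>The signed matrix\<close>

context nonneg_irreducible
begin

lemma simple_peripheral:
  assumes "z \<in> peripheral_spectrum (complex_mat P)"
  shows "simple_eigenvalue (complex_mat P) z"
proof -
  obtain es where es: "eigenvalue_enumeration (complex_mat P) es"
    using eigenvalue_enumeration_exists[OF complex_carrier] by blast
  then show ?thesis
    using assms count_peripheral[OF es assms] order_char_poly_eq_count[OF es]
    by (simp add: simple_eigenvalue_def peripheral_spectrum_eq)
qed

lemma imprimitivity_index_eq_card:
  "imprimitivity_index P = card (peripheral_spectrum (complex_mat P))"
  unfolding imprimitivity_index_def using simple_peripheral by (simp add: simple_eigenvalue_def)

end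

text \<open>These notions depend on the characteristic polynomial alone, which lets results for the
  signed matrix be read as results for \<open>A\<close>.\<close>

lemma char_poly_eq_imp_spectral_eq:
  fixes A B :: "complex mat"
  assumes A: "A \<in> carrier_mat n n" and B: "B \<in> carrier_mat n n" and eq: "char_poly A = char_poly B"
  shows "spectral_radius A = spectral_radius B" "peripheral_spectrum A = peripheral_spectrum B"
    "simple_eigenvalue A z \<longleftrightarrow> simple_eigenvalue B z"
    "eigenvalue_enumeration A es \<longleftrightarrow> eigenvalue_enumeration B es"
proof -
  have "spectrum A = spectrum B"
    unfolding spectrum_root_char_poly[OF A] spectrum_root_char_poly[OF B] eq ..
  then show "spectral_radius A = spectral_radius B" "peripheral_spectrum A = peripheral_spectrum B"
    by (simp_all add: spectral_radius_def peripheral_spectrum_def)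
  show "simple_eigenvalue A z \<longleftrightarrow> simple_eigenvalue B z"
    unfolding simple_eigenvalue_def eigenvalue_root_char_poly[OF A] eigenvalue_root_char_poly[OF B] eq ..
  show "eigenvalue_enumeration A es \<longleftrightarrow> eigenvalue_enumeration B es"
    using A B eq by (simp add: eigenvalue_enumeration_def)
qed

definition set_sign :: "nat set \<Rightarrow> nat \<Rightarrow> real" where
  "set_sign J i = (if i \<in> J then - 1 else 1)"

text \<open>\<^const>\<open>set_sign\<close> is negative on the set, whereas \<^const>\<open>W_hat\<close> contains \<open>(i, j)\<close> with \<open>i < j\<close> and equal
  signs if the pair belongs to \<open>Jt\<close>; hence the minus sign for \<open>i < j\<close>.\<close>

definition pair_sign :: "nat \<Rightarrow> nat set \<Rightarrow> nat \<Rightarrow> nat \<Rightarrow> real" where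
  "pair_sign n Jt i j =
     (if i < j then - set_sign Jt (pair_number n i j)
      else if j < i then set_sign Jt (pair_number n j i) else 0)"

definition signed_mat :: "nat set \<Rightarrow> real mat \<Rightarrow> real mat" where
  "signed_mat J A = mat (dim_row A) (dim_row A) (\<lambda>(i, j). set_sign J i * set_sign J j * A $$ (i, j))"

lemma set_sign_square [simp]: "set_sign J i * set_sign J i = 1"
  by (simp add: set_sign_def)

lemma set_sign_nz [simp]: "set_sign J i \<noteq> 0"
  by (simp add: set_sign_def)

lemma pair_sign_swap: "pair_sign n Jt j i = - pair_sign n Jt i j"
  by (simp add: pair_sign_def)

text \<open>The signed matrix is a conjugate of \<open>A\<close> by a diagonal matrix of signs,
  which is its own inverse.\<close>

lemma char_poly_signed_mat:
  assumes A: "A \<in> carrier_mat n n"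
  shows "char_poly (complex_mat (signed_mat J A)) = char_poly (complex_mat A)"
proof (rule char_poly_similar, rule similar_matI)
  let ?D = "mat_diag n (\<lambda>i. complex_of_real (set_sign J i))"
  show "?D * ?D = 1\<^sub>m n" "?D * ?D = 1\<^sub>m n"
    by (simp_all add: mat_diag_diag flip: of_real_mult)
  have CA: "complex_mat A \<in> carrier_mat n n" using A by simp
  show "complex_mat (signed_mat J A) = ?D * complex_mat A * ?D"
    unfolding mat_diag_mult_left[OF CA]
    by (subst mat_diag_mult_right[of _ n n]) (use A in \<open>auto simp: signed_mat_def mult_ac\<close>)
qed (use A in \<open>auto simp: signed_mat_def\<close>)

lemma sign_symmetry_setD:
  assumes "sign_symmetry_set M J" "i < dim_row M" "j < dim_row M"
  shows "0 \<le> set_sign J i * set_sign J j * M $$ (i, j)"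
  using assms unfolding sign_symmetry_set_def set_sign_def by (auto simp: not_less) (metis not_less)+

text \<open>For increasing pairs the two minus signs in \<open>pair_sign\<close> cancel and an entry
  of \<open>second_compound\<close> remains. Swapping a pair changes the sign of both
  \<open>pair_sign\<close> and \<open>minor2\<close>.\<close>

lemma pair_sign_minor2_nonneg:
  assumes A: "A \<in> carrier_mat n n" and Jt: "sign_symmetry_set (second_compound A) Jt"
    and "i < n" "j < n" "k < n" "l < n"
  shows "0 \<le> pair_sign n Jt i j * pair_sign n Jt k l * minor2 A i j k l"
proof -
  have ordered: "0 \<le> pair_sign n Jt i j * pair_sign n Jt k l * minor2 A i j k l"
    if "i < j" "j < n" "k < l" "l < n" for i j k l
    using sign_symmetry_setD[OF Jt, of "pair_number n i j" "pair_number n k l"]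
      pair_number(1)[OF that(1,2)] pair_number(1)[OF that(3,4)] second_compound_entry[OF A that] A that
    by (simp add: pair_sign_def minor2_def)
  have swap: "minor2 A j i k l = - minor2 A i j k l" "minor2 A i j l k = - minor2 A i j k l" for i j k l
    by (simp_all add: minor2_def)
  have rows: "0 \<le> pair_sign n Jt i j * pair_sign n Jt k l * minor2 A i j k l"
    if "k < l" "l < n" for k l
  proof -
    consider "i < j" | "i = j" | "j < i" by linarith
    then show ?thesis
    proof cases
      case 1
      then show ?thesis using ordered that assms by blast
    next
      case 2
      then show ?thesis by (simp add: minor2_def)
    next
      case 3
      then show ?thesis
        using ordered[OF 3 \<open>i < n\<close> that] by (simp add: pair_sign_swap[of n Jt j i] swap(1)[of j i])
    qed
  qed
  consider "k < l" | "k = l" | "l < k" by linarith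
  then show ?thesis
  proof cases
    case 1
    then show ?thesis using rows assms by blast
  next
    case 2
    then show ?thesis by (simp add: minor2_def)
  next
    case 3
    then show ?thesis
      using rows[OF 3 \<open>k < n\<close>] by (simp add: pair_sign_swap[of n Jt l k] swap(2)[of _ _ l k])
  qed
qed

text \<open>Conjugation by the signs of \<open>J\<close> multiplies a minor by the signs of its two
  rows and two columns; the factors \<open>set_sign J i * set_sign J j\<close> in the pair signs
  absorb them.\<close>

lemma sign_regular_irreducible_signed_mat:
  assumes "2 \<le> n" and A: "A \<in> carrier_mat n n" and irr: "irreducible_mat A"
    and J: "sign_symmetry_set A J" and Jt: "sign_symmetry_set (second_compound A) Jt"
  shows "sign_regular_irreducible n (\<lambda>i j. set_sign J i * set_sign J j * pair_sign n Jt i j) (signed_mat J A)"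
proof unfold_locales
  show "2 \<le> n" by fact
  show "signed_mat J A \<in> carrier_mat n n"
    using A by (simp add: signed_mat_def)
  have entry: "signed_mat J A $$ (i, j) = set_sign J i * set_sign J j * A $$ (i, j)" if "i < n" "j < n" for i j
    using A that by (simp add: signed_mat_def)
  show "0 \<le> signed_mat J A $$ (i, j)" if "i < n" "j < n" for i j
    using sign_symmetry_setD[OF J, of i j] A that by (simp add: entry)
  show "\<exists>i\<in>K. \<exists>j\<in>{..<n} - K. signed_mat J A $$ (i, j) \<noteq> 0"
    if K: "K \<subseteq> {..<n}" "K \<noteq> {}" "K \<noteq> {..<n}" for K
  proof (rule ccontr)
    assume "\<not> ?thesis"
    then have "A $$ (i, j) = 0" if "i \<in> K" "j \<in> {..<n} - K" for i j
      using K(1) that entry[of i j] by auto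
    then show False
      using reducible_mat_if_invariant[OF A K] irr by (simp add: irreducible_mat_def)
  qed
  let ?s = "\<lambda>i j. set_sign J i * set_sign J j * pair_sign n Jt i j"
  show "?s i j * ?s i j = 1" if "i \<noteq> j" for i j
  proof -
    have "?s i j * ?s i j = (set_sign J i * set_sign J i) * (set_sign J j * set_sign J j) *
        (pair_sign n Jt i j * pair_sign n Jt i j)"
      by (simp only: mult_ac)
    also have "pair_sign n Jt i j * pair_sign n Jt i j = 1"
      using that by (auto simp: pair_sign_def)
    finally show ?thesis by (simp only: set_sign_square mult_1_left)
  qed
  show "0 \<le> ?s i j * ?s k l * minor2 (signed_mat J A) i j k l" if "i < n" "j < n" "k < n" "l < n" for i j k l
  proof -
    have "?s i j * ?s k l * minor2 (signed_mat J A) i j k l =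
        (set_sign J i * set_sign J i) * (set_sign J j * set_sign J j) *
        (set_sign J k * set_sign J k) * (set_sign J l * set_sign J l) *
        (pair_sign n Jt i j * pair_sign n Jt k l * minor2 A i j k l)"
      unfolding minor2_def entry[OF that(1,3)] entry[OF that(2,4)] entry[OF that(1,4)] entry[OF that(2,3)]
      by (simp only: algebra_simps)
    also have "\<dots> = pair_sign n Jt i j * pair_sign n Jt k l * minor2 A i j k l"
      by (simp only: set_sign_square mult_1_left)
    also have "0 \<le> \<dots>" by (rule pair_sign_minor2_nonneg[OF A Jt that])
    finally show ?thesis .
  qed
qed

text \<open>Off the diagonal the clauses of \<open>W_hat\<close> are exactly the cases in which the
  product of signs is \<open>1\<close>, and transitivity ignores the diagonal.\<close>

lemma transitive_W_hat_iff:
  "transitive_W n (W_hat n J Jt) \<longleftrightarrow>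
    transitive_W n {(i, j). set_sign J i * set_sign J j * pair_sign n Jt i j = 1}"
proof -
  have "(i, j) \<in> W_hat n J Jt \<longleftrightarrow> set_sign J i * set_sign J j * pair_sign n Jt i j = 1"
    if "i < n" "j < n" "i \<noteq> j" for i j
    using that by (auto simp: W_hat_def set_sign_def pair_sign_def)
  then show ?thesis
    unfolding transitive_W_def by auto
qed

theorem theorem8:
  fixes A :: "real mat" and n :: nat
  assumes "n \<ge> 2"
    and "A \<in> carrier_mat n n"
    and "J_sign_symmetric A"
    and "irreducible_mat A"
    and "J_sign_symmetric (second_compound A)"
  shows "rho A > 0 \<and> simple_eigenvalue (complex_mat A) (complex_of_real (rho A)) \<and>
    ((\<exists>W \<in> possible_W_hats A. transitive_W n W) \<longrightarrow>
       imprimitivity_index A = 1 \<and>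
       (\<exists>es l2. eigenvalue_enumeration (complex_mat A) es \<and>
          sorted_wrt (\<lambda>x y. cmod x \<ge> cmod y) es \<and>
          es ! 0 = complex_of_real (rho A) \<and>
          es ! 1 = complex_of_real l2 \<and> 0 \<le> l2 \<and> l2 < rho A)) \<and>
    ((\<forall>W \<in> possible_W_hats A. \<not> transitive_W n W) \<longrightarrow>
       (\<exists>k. odd k \<and> k \<ge> 1 \<and> imprimitivity_index A = k \<and>
          (\<forall>z \<in> peripheral_spectrum (complex_mat A). simple_eigenvalue (complex_mat A) z) \<and>
          peripheral_spectrum (complex_mat A) = {z. z ^ k = complex_of_real (rho A ^ k)}))"
proof -
  note A = \<open>A \<in> carrier_mat n n\<close>
  have C: "complex_mat A \<in> carrier_mat n n" "complex_mat (signed_mat J A) \<in> carrier_mat n n" for J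
    using A by (simp_all add: signed_mat_def)
  note eq = char_poly_eq_imp_spectral_eq[OF C(2) C(1) char_poly_signed_mat[OF A]]
  have index_eq: "imprimitivity_index (signed_mat J A) = imprimitivity_index A" for J
    unfolding imprimitivity_index_def eq char_poly_signed_mat[OF A] ..
  have regular: "sign_regular_irreducible n (\<lambda>i j. set_sign J i * set_sign J j * pair_sign n Jt i j) (signed_mat J A)"
    if "sign_symmetry_set A J" "sign_symmetry_set (second_compound A) Jt" for J Jt
    using assms that by (intro sign_regular_irreducible_signed_mat)
  \<comment> \<open>The signed matrix has the same spectral data as \<open>A\<close> for every
    admissible choice, so any one choice can be fixed here.\<close>
  obtain J Jt where "sign_symmetry_set A J" "sign_symmetry_set (second_compound A) Jt"
    using assms(3,5) by (auto simp: J_sign_symmetric_def)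
  then interpret sign_regular_irreducible n
      "\<lambda>i j. set_sign J i * set_sign J j * pair_sign n Jt i j" "signed_mat J A"
    by (rule regular)
  let ?k = "card (peripheral_spectrum (complex_mat A))"
  have first: "rho A > 0" "simple_eigenvalue (complex_mat A) (complex_of_real (rho A))"
    using r_pos simple_peripheral[OF r_peripheral] by (simp_all only: eq)
  have odd: "odd ?k"
    using odd_card_peripheral unfolding eq .
  moreover have "?k \<ge> 1" using odd by (cases ?k) auto
  moreover have "imprimitivity_index A = ?k"
    using imprimitivity_index_eq_card unfolding eq index_eq .
  moreover have "\<forall>z \<in> peripheral_spectrum (complex_mat A). simple_eigenvalue (complex_mat A) z"
    using simple_peripheral unfolding eq by (rule ballI)
  moreover have "peripheral_spectrum (complex_mat A) = {z. z ^ ?k = complex_of_real (rho A ^ ?k)}"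
    using peripheral_spectrum_roots unfolding eq .
  ultimately have part2: "\<exists>k. odd k \<and> k \<ge> 1 \<and> imprimitivity_index A = k \<and>
      (\<forall>z \<in> peripheral_spectrum (complex_mat A). simple_eigenvalue (complex_mat A) z) \<and>
      peripheral_spectrum (complex_mat A) = {z. z ^ k = complex_of_real (rho A ^ k)}"
    by (intro exI[of _ ?k] conjI)
  have part1: "imprimitivity_index A = 1 \<and>
      (\<exists>es l2. eigenvalue_enumeration (complex_mat A) es \<and>
        sorted_wrt (\<lambda>x y. cmod x \<ge> cmod y) es \<and>
        es ! 0 = complex_of_real (rho A) \<and>
        es ! 1 = complex_of_real l2 \<and> 0 \<le> l2 \<and> l2 < rho A)"
    if possible: "W \<in> possible_W_hats A" and trans: "transitive_W n W" for W
  proof -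
    \<comment> \<open>The transitive set comes with its own \<open>J\<close> and \<open>Jt\<close>,
      so the locale is interpreted anew for them.\<close>
    obtain J Jt where W: "W = W_hat n J Jt"
      and "sign_symmetry_set A J" "sign_symmetry_set (second_compound A) Jt"
      using possible A by (auto simp: possible_W_hats_def)
    then interpret W: sign_regular_irreducible n
        "\<lambda>i j. set_sign J i * set_sign J j * pair_sign n Jt i j" "signed_mat J A"
      by (intro regular)
    obtain m where "m < n" "signed_mat J A $$ (m, m) \<noteq> 0"
    proof (rule W.diag_pos_if_transitive)
      show "set_sign J j * set_sign J i * pair_sign n Jt j i = - (set_sign J i * set_sign J j * pair_sign n Jt i j)"
        for i j
        by (simp add: pair_sign_swap[of n Jt j i])
      show "transitive_W n {(i, j). set_sign J i * set_sign J j * pair_sign n Jt i j = 1}"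
        using trans unfolding W transitive_W_hat_iff .
    qed
    then have per: "peripheral_spectrum (complex_mat (signed_mat J A)) = {complex_of_real W.r}"
      by (rule W.peripheral_spectrum_if_diag)
    then have "imprimitivity_index A = 1"
      using W.imprimitivity_index_eq_card unfolding index_eq by simp
    then show ?thesis
      using W.second_eigenvalue[OF per] unfolding eq by blast
  qed
  show ?thesis using first part1 part2 by blast
qed

end
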